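(* Let $S$ be a multiplicatively closed set in a ring $A$ and let $R = S^{-1}A$ be a ring of dimension at most $d$. Let $Q$ be a finitely presented $A$-module such that $P = S^{-1}Q$ is a projective $R$-module of rank $r \geq d + 1$. Suppose $(a, x) \in \mathrm{Um}(R \oplus P)$ for some $(a, x) \in A \oplus Q$, and $Q = Ax + Q'$ for some finitely generated $A$-submodule $Q'$ of $Q$. Then for any $s \in S$ there is $y \in Q'$ such that $x + say \in \mathrm{Um}(P)$.
   Context: All rings are commutative with unity $1 \neq 0$, not necessarily noetherian; dimension means Krull dimension; "rank $r$" means constant rank $r$. Elements of $A$ and $Q$ are identified with their images in $R$ and $P$ when unimodularity is considered. For a projective $R$-module $M$, $p \in M$ is unimodular if $\phi(p) = 1$ for some $\phi \in \mathrm{Hom}_R(M, R)$; $\mathrm{Um}(M)$ is the set of unimodular elements of $M$. *)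

theory Defs
  imports "HOL-Library.Extended_Nat" "HOL-Algebra.Module" "HOL-Algebra.Ideal"
begin

section \<open>Modules\<close>

text \<open>The fields \<open>mult\<close> and \<open>one\<close> of a record of type \<open>module\<close> play no role in the
  locale \<open>module\<close>; they are left \<open>undefined\<close> where nothing natural is available.\<close>

definition regular_module :: "('a, 'k) ring_scheme \<Rightarrow> ('a, 'a) module"
  where "regular_module R =
    \<lparr>carrier = carrier R, mult = mult R, one = one R, zero = zero R, add = add R, smult = mult R\<rparr>"

definition direct_sum ::
    "('a, 'm, 'k) module_scheme \<Rightarrow> ('a, 'n, 'l) module_scheme \<Rightarrow> ('a, 'm \<times> 'n) module"
  where "direct_sum M N =
    \<lparr>carrier = carrier M \<times> carrier N,
     mult = undefined,
     one = undefined,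
     zero = (\<zero>\<^bsub>M\<^esub>, \<zero>\<^bsub>N\<^esub>),
     add = (\<lambda>(x, y) (x', y'). (x \<oplus>\<^bsub>M\<^esub> x', y \<oplus>\<^bsub>N\<^esub> y')),
     smult = (\<lambda>a (x, y). (a \<odot>\<^bsub>M\<^esub> x, a \<odot>\<^bsub>N\<^esub> y))\<rparr>"

text \<open>The free module with basis indexed by \<open>I\<close>: finitely supported families of scalars
  (extended by zero outside \<open>I\<close>).\<close>

definition free_module :: "('a, 'k) ring_scheme \<Rightarrow> 'i set \<Rightarrow> ('a, 'i \<Rightarrow> 'a) module"
  where "free_module R I =
    \<lparr>carrier = {f. (\<forall>i\<in>I. f i \<in> carrier R) \<and> (\<forall>i. i \<notin> I \<longrightarrow> f i = \<zero>\<^bsub>R\<^esub>) \<and>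
                   finite {i \<in> I. f i \<noteq> \<zero>\<^bsub>R\<^esub>}},
     mult = undefined,
     one = undefined,
     zero = (\<lambda>i. \<zero>\<^bsub>R\<^esub>),
     add = (\<lambda>f g i. f i \<oplus>\<^bsub>R\<^esub> g i),
     smult = (\<lambda>a f i. a \<otimes>\<^bsub>R\<^esub> f i)\<rparr>"

definition mod_hom ::
    "('a, 'k) ring_scheme \<Rightarrow> ('a, 'm, 'l) module_scheme \<Rightarrow> ('a, 'n, 'j) module_scheme \<Rightarrow> ('m \<Rightarrow> 'n) set"
  where "mod_hom R M N =
    {f \<in> carrier M \<rightarrow> carrier N.
       (\<forall>x\<in>carrier M. \<forall>y\<in>carrier M. f (x \<oplus>\<^bsub>M\<^esub> y) = f x \<oplus>\<^bsub>N\<^esub> f y) \<and>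
       (\<forall>a\<in>carrier R. \<forall>x\<in>carrier M. f (a \<odot>\<^bsub>M\<^esub> x) = a \<odot>\<^bsub>N\<^esub> f x)}"

definition mod_isomorphic ::
    "('a, 'k) ring_scheme \<Rightarrow> ('a, 'm, 'l) module_scheme \<Rightarrow> ('a, 'n, 'j) module_scheme \<Rightarrow> bool"
  where "mod_isomorphic R M N \<longleftrightarrow> (\<exists>f\<in>mod_hom R M N. bij_betw f (carrier M) (carrier N))"

definition submodule_span ::
    "('a, 'k) ring_scheme \<Rightarrow> ('a, 'm, 'l) module_scheme \<Rightarrow> 'm set \<Rightarrow> 'm set"
  where "submodule_span R M X = (\<lambda>N. submodule N R M) hull X"

definition fg_submodule ::
    "'m set \<Rightarrow> ('a, 'k) ring_scheme \<Rightarrow> ('a, 'm, 'l) module_scheme \<Rightarrow> bool"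
  where "fg_submodule N R M \<longleftrightarrow>
    submodule N R M \<and> (\<exists>X. finite X \<and> X \<subseteq> carrier M \<and> N = submodule_span R M X)"

definition finitely_presented ::
    "('a, 'k) ring_scheme \<Rightarrow> ('a, 'm, 'l) module_scheme \<Rightarrow> bool"
  where "finitely_presented R M \<longleftrightarrow>
    module R M \<and>
    (\<exists>n::nat. \<exists>f\<in>mod_hom R (free_module R {..<n}) M.
       f ` carrier (free_module R {..<n}) = carrier M \<and>
       fg_submodule (a_kernel (free_module R {..<n}) M f) R (free_module R {..<n}))"

text \<open>A module is projective if it is a direct summand of a free module.  Restricting the types
  of the index set and of the complement loses no generality: if \<open>M\<close> is projective, then the
  canonical surjection onto \<open>M\<close> from the free module on the set \<open>carrier M\<close> splits, and its
  kernel is a complement.\<close>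

definition projective ::
    "('a, 'k) ring_scheme \<Rightarrow> ('a, 'm, 'l) module_scheme \<Rightarrow> bool"
  where "projective R M \<longleftrightarrow>
    module R M \<and>
    (\<exists>(I :: 'm set) (N :: ('a, 'm \<Rightarrow> 'a) module).
       module R N \<and> mod_isomorphic R (direct_sum M N) (free_module R I))"

definition Um :: "('a, 'k) ring_scheme \<Rightarrow> ('a, 'm, 'l) module_scheme \<Rightarrow> 'm set"
  where "Um R M =
    {p \<in> carrier M. \<exists>\<phi>\<in>mod_hom R M (regular_module R). \<phi> p = \<one>\<^bsub>R\<^esub>}"


section \<open>Localization\<close>

text \<open>The fraction \<open>x / s\<close> is the set of all pairs \<open>(y, t)\<close> such that
  \<open>u (t x - s y) = 0\<close> for some \<open>u \<in> S\<close>.\<close>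

definition fraction ::
    "('a, 'k) ring_scheme \<Rightarrow> 'a set \<Rightarrow> ('a, 'm, 'l) module_scheme \<Rightarrow> 'm \<Rightarrow> 'a \<Rightarrow> ('m \<times> 'a) set"
  where "fraction R S M x s =
    {(y, t). y \<in> carrier M \<and> t \<in> S \<and> (\<exists>u\<in>S. u \<odot>\<^bsub>M\<^esub> (t \<odot>\<^bsub>M\<^esub> x) = u \<odot>\<^bsub>M\<^esub> (s \<odot>\<^bsub>M\<^esub> y))}"

text \<open>Operations on fractions are defined as unions over all representatives; see
  \<open>add_fraction\<close>, \<open>smult_fraction\<close> and \<open>mult_fraction\<close> below for the resulting formulas.\<close>

definition loc_module ::
    "('a, 'k) ring_scheme \<Rightarrow> 'a set \<Rightarrow> ('a, 'm, 'l) module_scheme \<Rightarrow> (('a \<times> 'a) set, ('m \<times> 'a) set) module"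
  where "loc_module R S M =
    \<lparr>carrier = {fraction R S M x s | x s. x \<in> carrier M \<and> s \<in> S},
     mult = undefined,
     one = undefined,
     zero = fraction R S M \<zero>\<^bsub>M\<^esub> \<one>\<^bsub>R\<^esub>,
     add = (\<lambda>X Y. \<Union>(x, s)\<in>X. \<Union>(y, t)\<in>Y.
       fraction R S M (t \<odot>\<^bsub>M\<^esub> x \<oplus>\<^bsub>M\<^esub> s \<odot>\<^bsub>M\<^esub> y) (s \<otimes>\<^bsub>R\<^esub> t)),
     smult = (\<lambda>A X. \<Union>(a, s)\<in>A. \<Union>(x, t)\<in>X. fraction R S M (a \<odot>\<^bsub>M\<^esub> x) (s \<otimes>\<^bsub>R\<^esub> t))\<rparr>"

definition loc_ring :: "('a, 'k) ring_scheme \<Rightarrow> 'a set \<Rightarrow> (('a \<times> 'a) set) ring"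
  where "loc_ring R S =
    \<lparr>carrier = carrier (loc_module R S (regular_module R)),
     mult = smult (loc_module R S (regular_module R)),
     one = fraction R S (regular_module R) \<one>\<^bsub>R\<^esub> \<one>\<^bsub>R\<^esub>,
     zero = zero (loc_module R S (regular_module R)),
     add = add (loc_module R S (regular_module R))\<rparr>"

definition loc_map ::
    "('a, 'k) ring_scheme \<Rightarrow> 'a set \<Rightarrow> ('a, 'm, 'l) module_scheme \<Rightarrow> 'm \<Rightarrow> ('m \<times> 'a) set"
  where "loc_map R S M x = fraction R S M x \<one>\<^bsub>R\<^esub>"


section \<open>Rank and dimension\<close>

definition has_constant_rank ::
    "('a, 'k) ring_scheme \<Rightarrow> ('a, 'm, 'l) module_scheme \<Rightarrow> nat \<Rightarrow> bool"
  where "has_constant_rank R M r \<longleftrightarrow>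
    (\<forall>p. primeideal p R \<longrightarrow>
       mod_isomorphic (loc_ring R (carrier R - p)) (loc_module R (carrier R - p) M)
         (free_module (loc_ring R (carrier R - p)) {..<r}))"

text \<open>For the zero ring this is \<open>0\<close>, as a supremum of the empty set.\<close>

definition krull_dim :: "('a, 'k) ring_scheme \<Rightarrow> enat"
  where "krull_dim R =
    Sup {enat n | n. \<exists>p :: nat \<Rightarrow> 'a set.
           (\<forall>i\<le>n. primeideal (p i) R) \<and> (\<forall>i<n. p i \<subset> p (Suc i))}"


section \<open>The localization is a module over the localized ring\<close>

lemma UN_fractions_eq:
  assumes "(x, s) \<in> X" "(y, t) \<in> Y"
    "\<And>x' s' y' t'. (x', s') \<in> X \<Longrightarrow> (y', t') \<in> Y \<Longrightarrow> F x' s' y' t' = F x s y t"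
  shows "(\<Union>(x, s)\<in>X. \<Union>(y, t)\<in>Y. F x s y t) = F x s y t"
proof -
  have "(\<Union>(x, s)\<in>X. \<Union>(y, t)\<in>Y. F x s y t) = (\<Union>_\<in>X. \<Union>_\<in>Y. F x s y t)"
    using assms(3) by (intro SUP_cong refl) (auto split: prod.split intro!: SUP_cong)
  then show ?thesis
    using assms(1,2) by auto
qed

locale localization = module R M for R :: "('a, 'k) ring_scheme" (structure)
    and M :: "('a, 'm, 'l) module_scheme" (structure) +
  fixes S
  assumes S: "submonoid S R"
begin

lemma S_carrier [simp, intro]: "s \<in> S \<Longrightarrow> s \<in> carrier R"
  and S_mult [simp, intro]: "s \<in> S \<Longrightarrow> t \<in> S \<Longrightarrow> s \<otimes> t \<in> S"
  and S_one [simp, intro]: "\<one> \<in> S"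
  using S by (auto simp: submonoid_def)

lemma smult_left_commute:
  "a \<in> carrier R \<Longrightarrow> b \<in> carrier R \<Longrightarrow> x \<in> carrier M \<Longrightarrow>
    a \<odot>\<^bsub>M\<^esub> (b \<odot>\<^bsub>M\<^esub> x) = b \<odot>\<^bsub>M\<^esub> (a \<odot>\<^bsub>M\<^esub> x)"
  by (metis smult_assoc1 R.m_comm)

lemma fraction_self: "x \<in> carrier M \<Longrightarrow> s \<in> S \<Longrightarrow> (x, s) \<in> fraction R S M x s"
  unfolding fraction_def by auto

lemma mem_fraction_sym:
  assumes "x \<in> carrier M" "s \<in> S" "(y, t) \<in> fraction R S M x s"
  shows "(x, s) \<in> fraction R S M y t"
  using assms unfolding fraction_def by auto metis

lemma mem_fraction_trans:
  assumes "x \<in> carrier M" "s \<in> S" "(y, t) \<in> fraction R S M x s" "(z, w) \<in> fraction R S M y t"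
  shows "(z, w) \<in> fraction R S M x s"
proof -
  from assms obtain u v where y: "y \<in> carrier M" "t \<in> S" "u \<in> S"
    and z: "z \<in> carrier M" "w \<in> S" "v \<in> S"
    and u: "u \<odot>\<^bsub>M\<^esub> (t \<odot>\<^bsub>M\<^esub> x) = u \<odot>\<^bsub>M\<^esub> (s \<odot>\<^bsub>M\<^esub> y)"
    and v: "v \<odot>\<^bsub>M\<^esub> (w \<odot>\<^bsub>M\<^esub> y) = v \<odot>\<^bsub>M\<^esub> (t \<odot>\<^bsub>M\<^esub> z)"
    unfolding fraction_def by auto
  have "(u \<otimes> v \<otimes> t) \<odot>\<^bsub>M\<^esub> (w \<odot>\<^bsub>M\<^esub> x) = v \<odot>\<^bsub>M\<^esub> (w \<odot>\<^bsub>M\<^esub> (u \<odot>\<^bsub>M\<^esub> (t \<odot>\<^bsub>M\<^esub> x)))"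
    using assms(1,2) y z by (simp add: smult_assoc1 smult_left_commute)
  also have "\<dots> = u \<odot>\<^bsub>M\<^esub> (s \<odot>\<^bsub>M\<^esub> (v \<odot>\<^bsub>M\<^esub> (w \<odot>\<^bsub>M\<^esub> y)))"
    unfolding u using assms(1,2) y z by (simp add: smult_left_commute)
  also have "\<dots> = (u \<otimes> v \<otimes> t) \<odot>\<^bsub>M\<^esub> (s \<odot>\<^bsub>M\<^esub> z)"
    unfolding v using assms(1,2) y z by (simp add: smult_assoc1 smult_left_commute)
  finally show ?thesis
    using y z unfolding fraction_def by blast
qed

lemma fraction_eq_iff_mem:
  assumes "x \<in> carrier M" "s \<in> S" "y \<in> carrier M" "t \<in> S"
  shows "fraction R S M x s = fraction R S M y t \<longleftrightarrow> (y, t) \<in> fraction R S M x s"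
proof
  assume "(y, t) \<in> fraction R S M x s"
  then show "fraction R S M x s = fraction R S M y t"
    using mem_fraction_trans[OF assms(1,2), of y t] mem_fraction_trans[OF assms(3,4), of x s]
      mem_fraction_sym[OF assms(1,2), of y t]
    by (intro equalityI subrelI) blast+
next
  assume "fraction R S M x s = fraction R S M y t"
  then show "(y, t) \<in> fraction R S M x s"
    using fraction_self[OF assms(3,4)] by simp
qed

lemma fraction_eq_iff:
  assumes "x \<in> carrier M" "s \<in> S" "y \<in> carrier M" "t \<in> S"
  shows "fraction R S M x s = fraction R S M y t \<longleftrightarrow>
    (\<exists>u\<in>S. u \<odot>\<^bsub>M\<^esub> (t \<odot>\<^bsub>M\<^esub> x) = u \<odot>\<^bsub>M\<^esub> (s \<odot>\<^bsub>M\<^esub> y))"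
  unfolding fraction_eq_iff_mem[OF assms] using assms by (simp add: fraction_def)

lemma fraction_eqI:
  assumes "x \<in> carrier M" "s \<in> S" "y \<in> carrier M" "t \<in> S" "u \<in> S"
    "u \<odot>\<^bsub>M\<^esub> (t \<odot>\<^bsub>M\<^esub> x) = u \<odot>\<^bsub>M\<^esub> (s \<odot>\<^bsub>M\<^esub> y)"
  shows "fraction R S M x s = fraction R S M y t"
  using assms fraction_eq_iff by blast

lemma add_fraction:
  assumes "x \<in> carrier M" "s \<in> S" "y \<in> carrier M" "t \<in> S"
  shows "fraction R S M x s \<oplus>\<^bsub>loc_module R S M\<^esub> fraction R S M y t =
    fraction R S M (t \<odot>\<^bsub>M\<^esub> x \<oplus>\<^bsub>M\<^esub> s \<odot>\<^bsub>M\<^esub> y) (s \<otimes> t)"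
proof -
  have *: "fraction R S M (t' \<odot>\<^bsub>M\<^esub> x' \<oplus>\<^bsub>M\<^esub> s' \<odot>\<^bsub>M\<^esub> y') (s' \<otimes> t') =
      fraction R S M (t \<odot>\<^bsub>M\<^esub> x \<oplus>\<^bsub>M\<^esub> s \<odot>\<^bsub>M\<^esub> y) (s \<otimes> t)"
    if xs: "(x', s') \<in> fraction R S M x s" and yt: "(y', t') \<in> fraction R S M y t" for x' s' y' t'
  proof -
    obtain u v where c: "x' \<in> carrier M" "s' \<in> S" "u \<in> S" "y' \<in> carrier M" "t' \<in> S" "v \<in> S"
      and u: "u \<odot>\<^bsub>M\<^esub> (s' \<odot>\<^bsub>M\<^esub> x) = u \<odot>\<^bsub>M\<^esub> (s \<odot>\<^bsub>M\<^esub> x')"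
      and v: "v \<odot>\<^bsub>M\<^esub> (t' \<odot>\<^bsub>M\<^esub> y) = v \<odot>\<^bsub>M\<^esub> (t \<odot>\<^bsub>M\<^esub> y')"
      using xs yt unfolding fraction_def by auto
    have "(u \<otimes> v) \<odot>\<^bsub>M\<^esub> ((s \<otimes> t) \<odot>\<^bsub>M\<^esub> (t' \<odot>\<^bsub>M\<^esub> x' \<oplus>\<^bsub>M\<^esub> s' \<odot>\<^bsub>M\<^esub> y')) =
        v \<odot>\<^bsub>M\<^esub> (t \<odot>\<^bsub>M\<^esub> (t' \<odot>\<^bsub>M\<^esub> (u \<odot>\<^bsub>M\<^esub> (s \<odot>\<^bsub>M\<^esub> x')))) \<oplus>\<^bsub>M\<^esub>
        u \<odot>\<^bsub>M\<^esub> (s \<odot>\<^bsub>M\<^esub> (s' \<odot>\<^bsub>M\<^esub> (v \<odot>\<^bsub>M\<^esub> (t \<odot>\<^bsub>M\<^esub> y'))))"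
      using assms c by (simp add: smult_assoc1 smult_r_distr smult_left_commute)
    also have "\<dots> = (u \<otimes> v) \<odot>\<^bsub>M\<^esub> ((s' \<otimes> t') \<odot>\<^bsub>M\<^esub> (t \<odot>\<^bsub>M\<^esub> x \<oplus>\<^bsub>M\<^esub> s \<odot>\<^bsub>M\<^esub> y))"
      unfolding u[symmetric] v[symmetric]
      using assms c by (simp add: smult_assoc1 smult_r_distr smult_left_commute)
    finally show ?thesis
      using assms c by (intro fraction_eqI[of _ _ _ _ "u \<otimes> v"]) auto
  qed
  show ?thesis
    using UN_fractions_eq[OF fraction_self[OF assms(1,2)] fraction_self[OF assms(3,4)],
        of "\<lambda>x s y t. fraction R S M (t \<odot>\<^bsub>M\<^esub> x \<oplus>\<^bsub>M\<^esub> s \<odot>\<^bsub>M\<^esub> y) (s \<otimes> t)"] *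
    by (simp add: loc_module_def)
qed

lemma smult_fraction:
  assumes "a \<in> carrier R" "s \<in> S" "x \<in> carrier M" "t \<in> S"
  shows "fraction R S (regular_module R) a s \<odot>\<^bsub>loc_module R S M\<^esub> fraction R S M x t =
    fraction R S M (a \<odot>\<^bsub>M\<^esub> x) (s \<otimes> t)"
proof -
  have *: "fraction R S M (a' \<odot>\<^bsub>M\<^esub> x') (s' \<otimes> t') = fraction R S M (a \<odot>\<^bsub>M\<^esub> x) (s \<otimes> t)"
    if as: "(a', s') \<in> fraction R S (regular_module R) a s"
      and xt: "(x', t') \<in> fraction R S M x t" for a' s' x' t'
  proof -
    obtain u v where c: "a' \<in> carrier R" "s' \<in> S" "u \<in> S" "x' \<in> carrier M" "t' \<in> S" "v \<in> S"
      and u: "u \<otimes> (s' \<otimes> a) = u \<otimes> (s \<otimes> a')"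
      and v: "v \<odot>\<^bsub>M\<^esub> (t' \<odot>\<^bsub>M\<^esub> x) = v \<odot>\<^bsub>M\<^esub> (t \<odot>\<^bsub>M\<^esub> x')"
      using as xt unfolding fraction_def regular_module_def by auto
    have "(u \<otimes> v) \<odot>\<^bsub>M\<^esub> ((s \<otimes> t) \<odot>\<^bsub>M\<^esub> (a' \<odot>\<^bsub>M\<^esub> x')) =
        (u \<otimes> (s \<otimes> a')) \<odot>\<^bsub>M\<^esub> (v \<odot>\<^bsub>M\<^esub> (t \<odot>\<^bsub>M\<^esub> x'))"
      using assms c by (simp add: smult_assoc1 smult_left_commute)
    also have "\<dots> = (u \<otimes> v) \<odot>\<^bsub>M\<^esub> ((s' \<otimes> t') \<odot>\<^bsub>M\<^esub> (a \<odot>\<^bsub>M\<^esub> x))"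
      unfolding u[symmetric] v[symmetric] using assms c by (simp add: smult_assoc1 smult_left_commute)
    finally show ?thesis
      using assms c by (intro fraction_eqI[of _ _ _ _ "u \<otimes> v"]) auto
  qed
  have "(a, s) \<in> fraction R S (regular_module R) a s"
    using assms by (auto simp: fraction_def regular_module_def)
  then show ?thesis
    using UN_fractions_eq[OF _ fraction_self[OF assms(3,4)], of a s "fraction R S (regular_module R) a s"
        "\<lambda>a s x t. fraction R S M (a \<odot>\<^bsub>M\<^esub> x) (s \<otimes> t)"] *
    by (simp add: loc_module_def)
qed

end

lemma (in cring) regular_module: "module R (regular_module R)"
proof -
  have "abelian_group (regular_module R)"
    by (rule abelian_groupI)
      (auto simp: regular_module_def a_ac intro: a_inv_closed l_neg)
  then show ?thesis
    by (intro module.intro module_axioms.intro is_cring)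
      (auto simp: regular_module_def l_distr r_distr m_assoc)
qed

lemma (in cring) localization_regular:
  "submonoid S R \<Longrightarrow> localization R (regular_module R) S"
  by (intro localization.intro localization_axioms.intro regular_module)

context localization begin

lemma mult_fraction:
  assumes "a \<in> carrier R" "s \<in> S" "b \<in> carrier R" "t \<in> S"
  shows "fraction R S (regular_module R) a s \<otimes>\<^bsub>loc_ring R S\<^esub> fraction R S (regular_module R) b t =
    fraction R S (regular_module R) (a \<otimes> b) (s \<otimes> t)"
  using localization.smult_fraction[OF R.localization_regular[OF S], of a s b t] assms
  by (simp add: loc_ring_def regular_module_def)

lemma abelian_group_loc_module: "abelian_group (loc_module R S M)"
proof (rule abelian_groupI)
  let ?L = "loc_module R S M"
  have carr: "X \<in> carrier ?L \<longleftrightarrow> (\<exists>x s. X = fraction R S M x s \<and> x \<in> carrier M \<and> s \<in> S)" for X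
    by (auto simp: loc_module_def)
  show "\<zero>\<^bsub>?L\<^esub> \<in> carrier ?L"
    by (auto simp: loc_module_def)
  show "X \<oplus>\<^bsub>?L\<^esub> Y \<in> carrier ?L" if "X \<in> carrier ?L" "Y \<in> carrier ?L" for X Y
    using that by (auto simp: carr add_fraction)
      (metis M.a_closed S_carrier S_mult smult_closed)
  show "X \<oplus>\<^bsub>?L\<^esub> Y \<oplus>\<^bsub>?L\<^esub> Z = X \<oplus>\<^bsub>?L\<^esub> (Y \<oplus>\<^bsub>?L\<^esub> Z)"
    if "X \<in> carrier ?L" "Y \<in> carrier ?L" "Z \<in> carrier ?L" for X Y Z
    using that
    by (auto simp: carr add_fraction smult_r_distr smult_assoc1 smult_left_commute M.a_ac R.m_ac)
  show "X \<oplus>\<^bsub>?L\<^esub> Y = Y \<oplus>\<^bsub>?L\<^esub> X" if "X \<in> carrier ?L" "Y \<in> carrier ?L" for X Y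
    using that by (auto simp: carr add_fraction M.a_ac R.m_ac)
  show "\<zero>\<^bsub>?L\<^esub> \<oplus>\<^bsub>?L\<^esub> X = X" if X: "X \<in> carrier ?L" for X
  proof -
    obtain x s where "X = fraction R S M x s" "x \<in> carrier M" "s \<in> S"
      using X carr by blast
    moreover have "\<zero>\<^bsub>?L\<^esub> = fraction R S M \<zero>\<^bsub>M\<^esub> \<one>"
      by (simp add: loc_module_def)
    ultimately show ?thesis
      by (simp add: add_fraction)
  qed
  show "\<exists>Y\<in>carrier ?L. Y \<oplus>\<^bsub>?L\<^esub> X = \<zero>\<^bsub>?L\<^esub>" if X: "X \<in> carrier ?L" for X
  proof -
    obtain x s where x: "X = fraction R S M x s" "x \<in> carrier M" "s \<in> S"
      using X carr by blast
    have "fraction R S M (\<ominus>\<^bsub>M\<^esub> x) s \<oplus>\<^bsub>?L\<^esub> X = fraction R S M \<zero>\<^bsub>M\<^esub> (s \<otimes> s)"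
      using x by (simp add: add_fraction smult_r_minus M.l_neg)
    also have "\<dots> = \<zero>\<^bsub>?L\<^esub>"
      using x by (simp add: loc_module_def) (rule fraction_eqI[of _ _ _ _ \<one>]; simp)
    finally show ?thesis
      using x carr by (metis M.a_inv_closed)
  qed
qed

end

lemma (in cring) cring_loc_ring:
  assumes "submonoid S R"
  shows "cring (loc_ring R S)"
proof -
  interpret L: localization R "regular_module R" S
    by (rule localization_regular[OF assms])
  let ?L = "loc_ring R S"
  let ?q = "fraction R S (regular_module R)"
  have reg: "carrier (regular_module R) = carrier R" "smult (regular_module R) = mult R"
    "add (regular_module R) = add R"
    by (simp_all add: regular_module_def)
  have carr: "X \<in> carrier ?L \<longleftrightarrow> (\<exists>x s. X = ?q x s \<and> x \<in> carrier R \<and> s \<in> S)" for X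
    by (auto simp: loc_module_def loc_ring_def reg)
  have one: "\<one>\<^bsub>?L\<^esub> = ?q \<one> \<one>"
    by (simp add: loc_ring_def)
  have add: "?q x s \<oplus>\<^bsub>?L\<^esub> ?q y t = ?q (t \<otimes> x \<oplus> s \<otimes> y) (s \<otimes> t)"
    if "x \<in> carrier R" "s \<in> S" "y \<in> carrier R" "t \<in> S" for x s y t
    using L.add_fraction[of x s y t] that by (simp add: loc_ring_def reg)
  interpret G: abelian_group "loc_module R S (regular_module R)"
    by (rule L.abelian_group_loc_module)
  have ab: "abelian_group ?L"
    by (rule abelian_groupI)
      (auto simp: loc_ring_def G.a_ac intro: G.a_inv_closed G.l_neg)
  have cm: "comm_monoid ?L"
  proof (rule comm_monoidI)
    show "\<one>\<^bsub>?L\<^esub> \<in> carrier ?L"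
      by (auto simp: carr one)
    show "X \<otimes>\<^bsub>?L\<^esub> Y \<in> carrier ?L" if "X \<in> carrier ?L" "Y \<in> carrier ?L" for X Y
      using that by (auto simp: carr L.mult_fraction) (metis L.S_mult m_closed)
    show "X \<otimes>\<^bsub>?L\<^esub> Y \<otimes>\<^bsub>?L\<^esub> Z = X \<otimes>\<^bsub>?L\<^esub> (Y \<otimes>\<^bsub>?L\<^esub> Z)"
      if "X \<in> carrier ?L" "Y \<in> carrier ?L" "Z \<in> carrier ?L" for X Y Z
      using that by (auto simp: carr L.mult_fraction m_ac)
    show "\<one>\<^bsub>?L\<^esub> \<otimes>\<^bsub>?L\<^esub> X = X" if "X \<in> carrier ?L" for X
      using that by (auto simp: carr one L.mult_fraction)
    show "X \<otimes>\<^bsub>?L\<^esub> Y = Y \<otimes>\<^bsub>?L\<^esub> X" if "X \<in> carrier ?L" "Y \<in> carrier ?L" for X Y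
      using that by (auto simp: carr L.mult_fraction m_ac)
  qed
  show ?thesis
  proof (rule cringI[OF ab cm])
    fix X Y Z assume "X \<in> carrier ?L" "Y \<in> carrier ?L" "Z \<in> carrier ?L"
    then obtain x s y t z w where *: "X = ?q x s" "Y = ?q y t" "Z = ?q z w"
      "x \<in> carrier R" "s \<in> S" "y \<in> carrier R" "t \<in> S" "z \<in> carrier R" "w \<in> S"
      by (auto simp: carr)
    show "(X \<oplus>\<^bsub>?L\<^esub> Y) \<otimes>\<^bsub>?L\<^esub> Z = X \<otimes>\<^bsub>?L\<^esub> Z \<oplus>\<^bsub>?L\<^esub> Y \<otimes>\<^bsub>?L\<^esub> Z"
      using * by (simp add: add L.mult_fraction)
        (rule L.fraction_eqI[of _ _ _ _ \<one>]; simp add: reg l_distr r_distr m_ac)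
  qed
qed

theorem (in localization) module_loc_module: "module (loc_ring R S) (loc_module R S M)"
proof -
  interpret L: localization R "regular_module R" S
    by (rule R.localization_regular[OF S])
  let ?L = "loc_ring R S" and ?N = "loc_module R S M"
  let ?q = "fraction R S (regular_module R)" and ?f = "fraction R S M"
  have reg: "carrier (regular_module R) = carrier R" "smult (regular_module R) = mult R"
    "add (regular_module R) = add R"
    by (simp_all add: regular_module_def)
  have add: "?q x s \<oplus>\<^bsub>?L\<^esub> ?q y t = ?q (t \<otimes> x \<oplus> s \<otimes> y) (s \<otimes> t)"
    if "x \<in> carrier R" "s \<in> S" "y \<in> carrier R" "t \<in> S" for x s y t
    using L.add_fraction[of x s y t] that by (simp add: loc_ring_def reg)
  have carrL: "X \<in> carrier ?L \<longleftrightarrow> (\<exists>x s. X = ?q x s \<and> x \<in> carrier R \<and> s \<in> S)" for X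
    by (auto simp: loc_module_def loc_ring_def reg)
  have carrN: "X \<in> carrier ?N \<longleftrightarrow> (\<exists>x s. X = ?f x s \<and> x \<in> carrier M \<and> s \<in> S)" for X
    by (auto simp: loc_module_def)
  show ?thesis
  proof (rule moduleI[OF R.cring_loc_ring[OF S] abelian_group_loc_module])
    fix a x assume "a \<in> carrier ?L" "x \<in> carrier ?N"
    then show "a \<odot>\<^bsub>?N\<^esub> x \<in> carrier ?N"
      by (auto simp: carrL carrN smult_fraction) (metis S_mult smult_closed)
  next
    fix a b x assume "a \<in> carrier ?L" "b \<in> carrier ?L" "x \<in> carrier ?N"
    then obtain a' s b' t x' w where *: "a = ?q a' s" "b = ?q b' t" "x = ?f x' w"
      "a' \<in> carrier R" "s \<in> S" "b' \<in> carrier R" "t \<in> S" "x' \<in> carrier M" "w \<in> S"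
      by (auto simp: carrL carrN)
    show "(a \<oplus>\<^bsub>?L\<^esub> b) \<odot>\<^bsub>?N\<^esub> x = a \<odot>\<^bsub>?N\<^esub> x \<oplus>\<^bsub>?N\<^esub> b \<odot>\<^bsub>?N\<^esub> x"
      using * by (simp add: add add_fraction smult_fraction)
        (rule fraction_eqI[of _ _ _ _ \<one>];
          simp add: smult_l_distr smult_r_distr smult_assoc1 smult_left_commute)
    show "(a \<otimes>\<^bsub>?L\<^esub> b) \<odot>\<^bsub>?N\<^esub> x = a \<odot>\<^bsub>?N\<^esub> (b \<odot>\<^bsub>?N\<^esub> x)"
      using * by (auto simp: mult_fraction smult_fraction smult_assoc1 R.m_assoc)
  next
    fix a x y assume "a \<in> carrier ?L" "x \<in> carrier ?N" "y \<in> carrier ?N"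
    then obtain a' s x' t y' w where *: "a = ?q a' s" "x = ?f x' t" "y = ?f y' w"
      "a' \<in> carrier R" "s \<in> S" "x' \<in> carrier M" "t \<in> S" "y' \<in> carrier M" "w \<in> S"
      by (auto simp: carrL carrN)
    show "a \<odot>\<^bsub>?N\<^esub> (x \<oplus>\<^bsub>?N\<^esub> y) = a \<odot>\<^bsub>?N\<^esub> x \<oplus>\<^bsub>?N\<^esub> a \<odot>\<^bsub>?N\<^esub> y"
      using * by (simp add: add_fraction smult_fraction)
        (rule fraction_eqI[of _ _ _ _ \<one>];
          simp add: smult_r_distr smult_assoc1 smult_left_commute)
  next
    fix x assume "x \<in> carrier ?N"
    then show "\<one>\<^bsub>?L\<^esub> \<odot>\<^bsub>?N\<^esub> x = x"
      by (auto simp: carrN loc_ring_def smult_fraction)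
  qed
qed

end

theory Submission
  imports Defs "HOL-Algebra.Ring_Divisibility"
begin

text \<open>An element \<open>z\<close> of \<open>P\<close> is unimodular if and only if no prime of \<open>R\<close> contains its order ideal,
  the set of all values of functionals at \<open>z\<close> (\<open>Um_iff_order_ideal\<close>). So \<open>x\<close> has to be moved
  inside \<open>x + saQ'\<close> until no prime contains its order ideal any more. Since \<open>s\<close> is a unit of
  \<open>R\<close>, it can be absorbed into \<open>a\<close>. Let \<open>n = d + 1\<close>.

  A single move uses a dual system: functionals \<open>\<phi> i\<close> and elements \<open>y k\<close> of \<open>Q'\<close>, for \<open>i\<close> and
  \<open>k\<close> less than \<open>n\<close>, such that \<open>\<phi> i (y k)\<close> is \<open>\<delta>\<close> on the diagonal and zero elsewhere.
  Translating \<open>x\<close> by combinations of the \<open>y k\<close> changes the \<open>n\<close> values \<open>\<phi> i x\<close> independently,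
  and Kronecker's theorem for rings of dimension less than \<open>n\<close> provides a translation, by a
  multiple of \<open>a\<delta>\<close>, such that every prime containing the new order ideal contains \<open>a\<delta>\<close>
  (\<open>ex_correction\<close>). It contains the old order ideal as well, so that moves for several \<open>\<delta>\<close> can
  be carried out one after the other. If no prime containing the order ideal of \<open>x\<close> contains
  all \<open>\<delta>\<close>, then finitely many moves suffice: a prime containing the final order ideal would
  contain \<open>a\<close> and the order ideal of \<open>x\<close>, against the unimodularity of \<open>(a, x)\<close>
  (\<open>ex_unimodular_translate\<close>).

  If a prime \<open>p\<close> contains the order ideal of \<open>x\<close>, then \<open>x\<close> contributes nothing to \<open>P\<close> modulo \<open>p\<close>.
  Since \<open>P\<close> is free of rank \<open>r \<ge> n\<close> at \<open>p\<close> and is generated by \<open>x\<close> and \<open>Q'\<close>, there are \<open>n\<close>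
  elements of \<open>Q'\<close> that are part of a basis at \<open>p\<close>, and elimination turns them and the
  coordinate functionals into a dual system with \<open>\<delta> \<notin> p\<close>
  (\<open>dual_systems_not_subset_prime\<close>).

  Two features of the argument for Kronecker's theorem matter here. As \<open>R\<close> may have infinitely
  many minimal primes, the induction on the dimension goes through boundary ideals instead of
  prime avoidance (\<open>no_prime_chain_boundary\<close>). And the coefficients that it yields may be
  multiplied by units, so they can be taken in the image of \<open>A\<close>, which keeps the translation
  inside the image of \<open>Q'\<close> (\<open>kronecker\<close>).\<close>

section \<open>Prime ideals avoiding a multiplicative set\<close>

lemma (in cring) set_add_supersets:
  assumes "ideal I R" "ideal J R"
  shows "I \<subseteq> I <+>\<^bsub>R\<^esub> J" "J \<subseteq> I <+>\<^bsub>R\<^esub> J"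
proof -
  interpret I: ideal I R by fact
  interpret J: ideal J R by fact
  show "I \<subseteq> I <+>\<^bsub>R\<^esub> J"
  proof
    fix x assume "x \<in> I"
    moreover from this have "x = x \<oplus> \<zero>" using I.Icarr by simp
    ultimately show "x \<in> I <+>\<^bsub>R\<^esub> J" unfolding set_add_def' using J.zero_closed by blast
  qed
  show "J \<subseteq> I <+>\<^bsub>R\<^esub> J"
  proof
    fix x assume "x \<in> J"
    moreover from this have "x = \<zero> \<oplus> x" using J.Icarr by simp
    ultimately show "x \<in> I <+>\<^bsub>R\<^esub> J" unfolding set_add_def' using I.zero_closed by blast
  qed
qed

text \<open>Krull's theorem: an ideal that is maximal among those containing \<open>I\<close> and missing \<open>M\<close> is
  prime, because two elements outside it generate, together with it, ideals that meet \<open>M\<close>, and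
  the product of two such meeting points lies in \<open>M\<close>.\<close>

lemma (in cring) ex_primeideal_disjoint:
  assumes I: "ideal I R" and M: "submonoid M R" and disj: "I \<inter> M = {}"
  shows "\<exists>p. primeideal p R \<and> I \<subseteq> p \<and> p \<inter> M = {}"
proof -
  have MC: "M \<subseteq> carrier R" and M1: "\<one> \<in> M" and MM: "\<And>x y. x \<in> M \<Longrightarrow> y \<in> M \<Longrightarrow> x \<otimes> y \<in> M"
    using M by (auto simp: submonoid_def)
  let ?F = "{J. ideal J R \<and> I \<subseteq> J \<and> J \<inter> M = {}}"
  have "\<exists>p\<in>?F. \<forall>J\<in>?F. p \<subseteq> J \<longrightarrow> J = p"
  proof (rule subset_Zorn_nonempty)
    show "?F \<noteq> {}" using I disj by blast
  next
    fix C assume C: "C \<noteq> {}" "subset.chain ?F C"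
    have sub: "C \<subseteq> ?F"
      using C(2) by (auto simp: subset.chain_def)
    have "subset.chain {J. ideal J R} C"
      using C(2) by (auto simp: subset.chain_def)
    from chain_Union_is_ideal[OF this] C(1) have "ideal (\<Union>C) R" by simp
    then show "\<Union>C \<in> ?F"
      using sub C(1) by blast
  qed
  then obtain p where pF: "p \<in> ?F" and max': "\<And>J. J \<in> ?F \<Longrightarrow> p \<subseteq> J \<Longrightarrow> J = p"
    by meson
  from pF have p: "ideal p R" "I \<subseteq> p" "p \<inter> M = {}"
    by simp_all
  have max: "J = p" if "ideal J R" "p \<subseteq> J" "J \<inter> M = {}" for J
    using max'[of J] that p(2) by simp
  interpret p: ideal p R by (rule p(1))
  have meets: "\<exists>m i r. m \<in> M \<and> i \<in> p \<and> r \<in> carrier R \<and> m = i \<oplus> r \<otimes> x"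
    if x: "x \<in> carrier R" "x \<notin> p" for x
  proof -
    have id: "ideal (p <+>\<^bsub>R\<^esub> PIdl x) R"
      by (rule add_ideals[OF p(1) cgenideal_ideal[OF x(1)]])
    note add = set_add_supersets[OF p(1) cgenideal_ideal[OF x(1)]]
    have sup: "p \<subseteq> p <+>\<^bsub>R\<^esub> PIdl x" "x \<in> p <+>\<^bsub>R\<^esub> PIdl x"
      using add cgenideal_self[OF x(1)] by blast+
    then have "(p <+>\<^bsub>R\<^esub> PIdl x) \<inter> M \<noteq> {}"
      using max[OF id sup(1)] x(2) by blast
    then obtain m where m: "m \<in> M" "m \<in> p <+>\<^bsub>R\<^esub> PIdl x"
      by blast
    then obtain i j where "i \<in> p" "j \<in> PIdl x" "m = i \<oplus> j"
      unfolding set_add_def' by blast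
    with m(1) show ?thesis
      unfolding cgenideal_def by blast
  qed
  have "primeideal p R"
  proof (rule primeidealI[OF p(1) is_cring])
    show "carrier R \<noteq> p" using p(3) M1 MC by blast
  next
    fix x y assume xy: "x \<in> carrier R" "y \<in> carrier R" "x \<otimes> y \<in> p"
    show "x \<in> p \<or> y \<in> p"
    proof (rule ccontr)
      assume "\<not> (x \<in> p \<or> y \<in> p)"
      then have nx: "x \<notin> p" and ny: "y \<notin> p"
        by simp_all
      obtain m i r m' i' r' where *: "m \<in> M" "i \<in> p" "r \<in> carrier R" "m = i \<oplus> r \<otimes> x"
        "m' \<in> M" "i' \<in> p" "r' \<in> carrier R" "m' = i' \<oplus> r' \<otimes> y"
        using meets[OF xy(1) nx] meets[OF xy(2) ny] by blast
      have "i \<otimes> m' \<oplus> ((r \<otimes> x) \<otimes> i' \<oplus> (r \<otimes> r') \<otimes> (x \<otimes> y)) \<in> p"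
        using p.I_r_closed[OF *(2), of m'] p.I_l_closed[OF *(6), of "r \<otimes> x"]
          p.I_l_closed[OF xy(3), of "r \<otimes> r'"] * xy MC by (intro p.a_closed) auto
      also have "i \<otimes> m' \<oplus> ((r \<otimes> x) \<otimes> i' \<oplus> (r \<otimes> r') \<otimes> (x \<otimes> y)) = m \<otimes> m'"
      proof -
        have c: "i \<in> carrier R" "i' \<in> carrier R" using * p.Icarr by auto
        have "r \<otimes> x \<otimes> m' = (r \<otimes> x) \<otimes> i' \<oplus> (r \<otimes> r') \<otimes> (x \<otimes> y)"
          unfolding *(8) using * xy c by (simp add: r_distr m_ac)
        moreover have "m \<otimes> m' = i \<otimes> m' \<oplus> r \<otimes> x \<otimes> m'"
          unfolding *(4) using * xy c MC by (subst l_distr) auto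
        ultimately show ?thesis by simp
      qed
      finally show False
        using MM[OF *(1,5)] p(3) by blast
    qed
  qed
  with p show ?thesis by blast
qed

corollary (in cring) mem_all_primes_imp_power_mem:
  assumes I: "ideal I R" and a: "a \<in> carrier R"
    and all: "\<And>p. primeideal p R \<Longrightarrow> I \<subseteq> p \<Longrightarrow> a \<in> p"
  shows "\<exists>m::nat. a [^] m \<in> I"
proof (rule ccontr)
  assume *: "\<not> ?thesis"
  have "submonoid (range (\<lambda>m::nat. a [^] m)) R"
  proof
    show "\<one> \<in> range (\<lambda>m::nat. a [^] m)" 
      by (rule range_eqI[of _ _ 0]) simp
    show "x \<otimes> y \<in> range (\<lambda>m::nat. a [^] m)" 
      if "x \<in> range (\<lambda>m::nat. a [^] m)" "y \<in> range (\<lambda>m::nat. a [^] m)" for x y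
      using that a by (auto simp: nat_pow_mult)
  qed (use a in auto)
  from ex_primeideal_disjoint[OF I this] * obtain p where
    p: "primeideal p R" "I \<subseteq> p" "p \<inter> range (\<lambda>m::nat. a [^] m) = {}" by auto
  moreover have "a [^] (1::nat) = a" using a by (simp add: nat_pow_eone)
  ultimately show False using all[OF p(1,2)] by (metis disjoint_iff rangeI)
qed

lemma (in primeideal) pow_mem: "a \<in> carrier R \<Longrightarrow> a [^] (m::nat) \<in> I \<Longrightarrow> a \<in> I"
proof (induction m)
  case 0
  then show ?case using one_imp_carrier I_notcarr by simp
next
  case (Suc m)
  then show ?case using I_prime[of "a [^] m" a] by auto
qed

lemma (in primeideal) one_notin: "\<one> \<notin> I"
  using one_imp_carrier I_notcarr by blast

corollary (in cring) ideal_eq_carrierI: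
  assumes "ideal I R" "\<And>p. primeideal p R \<Longrightarrow> \<not> I \<subseteq> p"
  shows "\<one> \<in> I"
  using mem_all_primes_imp_power_mem[of I \<one>] assms by auto

section \<open>Kronecker's theorem in finite Krull dimension\<close>

text \<open>For \<open>I = {\<zero>}\<close> and \<open>n > 0\<close> this says that the Krull dimension is less than \<open>n\<close>. Chains above an ideal
  \<open>I\<close> replace chains in the quotient by \<open>I\<close>, so that an induction on the dimension can stay
  inside one ring; \<open>n = 0\<close> means that \<open>I\<close> is the whole ring.\<close>

definition no_prime_chain :: "('a, 'k) ring_scheme \<Rightarrow> 'a set \<Rightarrow> nat \<Rightarrow> bool"
  where "no_prime_chain R I n \<longleftrightarrow>
    \<not> (\<exists>p :: nat \<Rightarrow> 'a set. (\<forall>i\<le>n. primeideal (p i) R \<and> I \<subseteq> p i) \<and> (\<forall>i<n. p i \<subset> p (Suc i)))"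

text \<open>A prime missing this set is contained in \<open>I\<close> and does not contain \<open>b\<close>; if \<open>b \<in> I\<close>, it is
  therefore strictly smaller than \<open>I\<close>.\<close>

lemma (in primeideal) submonoid_compl_powers:
  assumes b: "b \<in> carrier R"
  shows "submonoid {b [^] k \<otimes> s | (k::nat) s. s \<in> carrier R - I} R"
proof
  show "{b [^] k \<otimes> s | (k::nat) s. s \<in> carrier R - I} \<subseteq> carrier R" using b by auto
  show "\<one> \<in> {b [^] k \<otimes> s | (k::nat) s. s \<in> carrier R - I}"
    by (rule CollectI, rule exI[of _ 0], rule exI[of _ \<one>]) (use one_notin in auto)
  fix x y assume "x \<in> {b [^] k \<otimes> s | (k::nat) s. s \<in> carrier R - I}"
    "y \<in> {b [^] k \<otimes> s | (k::nat) s. s \<in> carrier R - I}"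
  then obtain k l :: nat and s t where *: "x = b [^] k \<otimes> s" "y = b [^] l \<otimes> t"
    "s \<in> carrier R" "s \<notin> I" "t \<in> carrier R" "t \<notin> I" by blast
  have "x \<otimes> y = b [^] (k + l) \<otimes> (s \<otimes> t)"
    using * b by (simp add: nat_pow_mult[symmetric] m_ac)
  moreover have "s \<otimes> t \<in> carrier R - I" using * I_prime by blast
  ultimately show "x \<otimes> y \<in> {b [^] k \<otimes> s | (k::nat) s. s \<in> carrier R - I}" by blast
qed

text \<open>The second summand is the quotient of the radical of \<open>I\<close> by \<open>b\<close>. In geometric terms the
  boundary ideal cuts out the intersection of the zero set of \<open>b\<close> with the closure of its
  complement, inside the zero set of \<open>I\<close>.\<close>

definition (in cring) boundary :: "'a set \<Rightarrow> 'a \<Rightarrow> 'a set"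
  where "boundary I b = PIdl b <+>\<^bsub>R\<^esub> {y \<in> carrier R. \<forall>q. primeideal q R \<and> I \<subseteq> q \<longrightarrow> y \<otimes> b \<in> q}"

lemma (in cring) annihilator_ideal:
  assumes "b \<in> carrier R"
  shows "ideal {y \<in> carrier R. \<forall>q. primeideal q R \<and> I \<subseteq> q \<longrightarrow> y \<otimes> b \<in> q} R" (is "ideal ?N R")
proof (rule idealI[OF ring_axioms])
  have add: "additive_subgroup q R" if "primeideal q R" for q
    using that ideal.axioms(1) primeideal.axioms(1) by blast
  show "subgroup ?N (add_monoid R)"
  proof (rule add.subgroupI)
    have "\<zero> \<in> ?N"
      using assms additive_subgroup.zero_closed[OF add] by simp
    then show "?N \<noteq> {}" by blast
  next
    fix y assume y: "y \<in> ?N"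
    then have "\<ominus> y \<otimes> b = \<ominus> (y \<otimes> b)" using assms by (simp add: l_minus)
    then show "\<ominus> y \<in> ?N"
      using y additive_subgroup.a_inv_closed[OF add] by simp
  next
    fix y z assume "y \<in> ?N" "z \<in> ?N"
    then show "y \<oplus> z \<in> ?N"
      using assms additive_subgroup.a_closed[OF add] by (simp add: l_distr)
  qed auto
next
  fix y r assume y: "y \<in> ?N" "r \<in> carrier R"
  have "(r \<otimes> y) \<otimes> b \<in> q" if "primeideal q R" "I \<subseteq> q" for q
    using y assms that ideal.I_l_closed[OF primeideal.axioms(1)[OF that(1)], of "y \<otimes> b" r]
    by (auto simp: m_assoc)
  then show "r \<otimes> y \<in> ?N" using y by auto
  moreover have "y \<otimes> r = r \<otimes> y" using y by (auto simp: m_comm)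
  ultimately show "y \<otimes> r \<in> ?N" by simp
qed

text \<open>Passing to the boundary lowers the dimension since a prime \<open>p\<close> above the boundary is never
  minimal above \<open>I\<close>. Otherwise \<open>b \<in> p\<close> would give
  \<open>b\<^sup>k s \<in> I\<close> for some \<open>s \<notin> p\<close>, and then \<open>s\<close> would lie in the boundary. So a chain above
  the boundary can be prolonged downwards by one prime.\<close>

lemma (in cring) no_prime_chain_boundary:
  assumes b: "b \<in> carrier R" and I: "ideal I R" and nc: "no_prime_chain R I (Suc n)"
  shows "no_prime_chain R (boundary I b) n"
  unfolding no_prime_chain_def
proof
  let ?N = "{y \<in> carrier R. \<forall>q. primeideal q R \<and> I \<subseteq> q \<longrightarrow> y \<otimes> b \<in> q}"
  assume "\<exists>p :: nat \<Rightarrow> 'a set. (\<forall>i\<le>n. primeideal (p i) R \<and> boundary I b \<subseteq> p i) \<and> (\<forall>i<n. p i \<subset> p (Suc i))"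
  then obtain p :: "nat \<Rightarrow> 'a set" where p: "\<And>i. i \<le> n \<Longrightarrow> primeideal (p i) R"
    "\<And>i. i \<le> n \<Longrightarrow> boundary I b \<subseteq> p i" and ch: "\<And>i. i < n \<Longrightarrow> p i \<subset> p (Suc i)" by blast
  note sup = set_add_supersets[OF cgenideal_ideal[OF b] annihilator_ideal[OF b], of I, folded boundary_def]
  have IN: "I \<subseteq> ?N"
  proof
    fix y assume y: "y \<in> I"
    have "y \<otimes> b \<in> q" if "primeideal q R" "I \<subseteq> q" for q
      using ideal.I_r_closed[OF primeideal.axioms(1)[OF that(1)]] that(2) y b by blast
    with y show "y \<in> ?N" using ideal.Icarr[OF I] by simp
  qed
  then have Ip: "I \<subseteq> p i" if "i \<le> n" for i using sup p(2)[OF that] by blast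
  interpret p0: primeideal "p 0" R by (rule p(1)) simp
  have b0: "b \<in> p 0" using sup(1) cgenideal_self[OF b] p(2)[of 0] by blast
  let ?M = "{b [^] k \<otimes> s | (k::nat) s. s \<in> carrier R - p 0}"
  have "I \<inter> ?M = {}"
  proof (rule ccontr)
    assume "I \<inter> ?M \<noteq> {}"
    then obtain k :: nat and s where s: "s \<in> carrier R" "s \<notin> p 0" "b [^] k \<otimes> s \<in> I" by blast
    have "s \<otimes> b \<in> q" if q: "primeideal q R" "I \<subseteq> q" for q
    proof -
      interpret q: primeideal q R by (rule q(1))
      have "b [^] k \<otimes> s \<in> q" using s(3) q(2) by blast
      then have "b [^] k \<in> q \<or> s \<in> q" using q.I_prime b s(1) nat_pow_closed by simp
      then have "b \<in> q \<or> s \<in> q" using q.pow_mem[OF b] by blast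
      then show ?thesis using q.I_l_closed q.I_r_closed b s by blast
    qed
    then have "s \<in> ?N" using s by blast
    then show False using sup(2) p(2)[of 0] s(2) by blast
  qed
  from ex_primeideal_disjoint[OF I p0.submonoid_compl_powers[OF b] this]
  obtain q where q: "primeideal q R" "I \<subseteq> q" "q \<inter> ?M = {}" by blast
  interpret q: primeideal q R by (rule q(1))
  have "s \<in> ?M" if s: "s \<in> carrier R - p 0" for s
  proof -
    have "s = b [^] (0::nat) \<otimes> s" using s by simp
    then show ?thesis using s by blast
  qed
  then have "q \<subseteq> p 0" using q(3) q.Icarr by blast
  moreover have "b \<in> ?M"
  proof -
    have "b = b [^] (1::nat) \<otimes> \<one>" using b by (simp add: nat_pow_eone)
    then show ?thesis using p0.one_notin by blast
  qed
  ultimately have q0: "q \<subset> p 0" using b0 q(3) by blast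
  let ?p = "\<lambda>i. case i of 0 \<Rightarrow> q | Suc j \<Rightarrow> p j"
  have "\<forall>i\<le>Suc n. primeideal (?p i) R \<and> I \<subseteq> ?p i"
    using q p Ip by (auto split: nat.split)
  moreover have "\<forall>i<Suc n. ?p i \<subset> ?p (Suc i)"
    using q0 ch by (auto split: nat.split)
  ultimately show False using nc unfolding no_prime_chain_def by blast
qed

text \<open>Up to radicals, \<open>n\<close> elements and one more element \<open>a\<close> generate the same ideal as \<open>n\<close>
  elements of the form \<open>b i + a x i\<close>. The induction applies the case \<open>n\<close> above the boundary of
  the last element \<open>c = b n\<close>, which writes a power of \<open>a\<close> as \<open>k + y\<close> with \<open>k\<close> in the
  ideal generated by \<open>c\<close> and the first \<open>n\<close> new elements, and with \<open>y c\<close> in every prime above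
  \<open>I\<close>. The last coefficient is \<open>y\<close>: a prime containing \<open>c + a y\<close> contains both \<open>c\<close> and
  \<open>a y\<close> since their product is nilpotent modulo \<open>I\<close>.

  All that is used about \<open>y\<close> survives multiplication by a unit. So the coefficients can be
  taken in any set \<open>T\<close> that meets every orbit of the units; for a ring of fractions
  \<open>S\<^sup>-\<^sup>1 A\<close>, in the image of \<open>A\<close>.\<close>

theorem (in cring) kronecker:
  assumes "ideal I R" "no_prime_chain R I n" "a \<in> carrier R" "\<And>i. i < n \<Longrightarrow> b i \<in> carrier R"
    and "T \<subseteq> carrier R" and T: "\<And>x. x \<in> carrier R \<Longrightarrow> \<exists>u\<in>Units R. u \<otimes> x \<in> T"
  shows "\<exists>x. (\<forall>i<n. x i \<in> T) \<and>
    (\<forall>p. primeideal p R \<longrightarrow> I \<subseteq> p \<longrightarrow> (\<forall>i<n. b i \<oplus> a \<otimes> x i \<in> p) \<longrightarrow> a \<in> p)"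
  using assms(1-4)
proof (induction n arbitrary: I)
  case 0
  from 0(2) have "\<not> (primeideal p R \<and> I \<subseteq> p)" for p
    unfolding no_prime_chain_def by (auto dest!: spec[of _ "\<lambda>_. p"])
  then show ?case by auto
next
  case (Suc n)
  define c where "c = b n"
  have c: "c \<in> carrier R" using Suc.prems by (simp add: c_def)
  let ?N = "{y \<in> carrier R. \<forall>q. primeideal q R \<and> I \<subseteq> q \<longrightarrow> y \<otimes> c \<in> q}"
  have Nid: "ideal ?N R" by (rule annihilator_ideal[OF c])
  have "ideal (boundary I c) R"
    unfolding boundary_def by (rule add_ideals[OF cgenideal_ideal[OF c] Nid])
  from Suc.IH[OF this no_prime_chain_boundary[OF c Suc.prems(1,2)] Suc.prems(3)] Suc.prems(4)
  obtain x where x': "\<forall>i<n. x i \<in> T" "\<forall>p. primeideal p R \<longrightarrow> boundary I c \<subseteq> p \<longrightarrow>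
      (\<forall>i<n. b i \<oplus> a \<otimes> x i \<in> p) \<longrightarrow> a \<in> p"
    by auto
  then have xT: "\<And>i. i < n \<Longrightarrow> x i \<in> T"
    and x: "\<And>p. primeideal p R \<Longrightarrow> boundary I c \<subseteq> p \<Longrightarrow> (\<And>i. i < n \<Longrightarrow> b i \<oplus> a \<otimes> x i \<in> p) \<Longrightarrow> a \<in> p"
    by simp_all
  have xR: "x i \<in> carrier R" if "i < n" for i using xT[OF that] assms(5) by blast
  let ?B = "insert c ((\<lambda>i. b i \<oplus> a \<otimes> x i) ` {..<n})"
  have B: "?B \<subseteq> carrier R" using Suc.prems(3,4) xR c by auto
  have Bid: "ideal (Idl ?B) R" by (rule genideal_ideal[OF B])
  note sup = set_add_supersets[OF Bid Nid]
  have "a \<in> p" if p: "primeideal p R" "Idl ?B <+>\<^bsub>R\<^esub> ?N \<subseteq> p" for p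
  proof -
    interpret p: primeideal p R by (rule p(1))
    have Bp: "?B \<subseteq> p" using sup(1) p(2) genideal_self[OF B] by blast
    have "PIdl c \<subseteq> p"
      by (rule cgenideal_minimal[OF p.is_ideal]) (use Bp in blast)
    moreover have "?N \<subseteq> p" using sup(2) p(2) by blast
    ultimately have "boundary I c \<subseteq> p"
      unfolding boundary_def set_add_def' using p.a_closed by blast
    then show ?thesis by (rule x[OF p(1)]) (use Bp in auto)
  qed
  from mem_all_primes_imp_power_mem[OF add_ideals[OF Bid Nid] Suc.prems(3) this]
  obtain m k y where m: "a [^] (m::nat) = k \<oplus> y" "k \<in> Idl ?B" "y \<in> ?N"
    unfolding set_add_def' by blast
  from m(3) have "y \<in> carrier R" by simp
  then obtain u where u: "u \<in> Units R" "u \<otimes> y \<in> T" using T by blast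
  have uR: "u \<in> carrier R" using u by blast
  show ?case
  proof (intro exI[of _ "x(n := u \<otimes> y)"] conjI allI impI)
    show "(x(n := u \<otimes> y)) i \<in> T" if "i < Suc n" for i using that xT u by auto
  next
    fix p assume p: "primeideal p R" "I \<subseteq> p"
      and h: "\<forall>i<Suc n. b i \<oplus> a \<otimes> (x(n := u \<otimes> y)) i \<in> p"
    interpret p: primeideal p R by (rule p(1))
    have yR: "y \<in> carrier R" using m by blast
    have yc: "y \<otimes> c \<in> p" using m p by blast
    have h1: "c \<oplus> a \<otimes> (u \<otimes> y) \<in> p" using h by (auto simp: c_def)
    \<comment> \<open>multiply \<open>c + a u y\<close> by \<open>c\<close> and use \<open>y c \<in> p\<close> to see that \<open>c\<close> squared lies in \<open>p\<close>\<close>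
    have "c \<in> p"
    proof -
      have "(c \<oplus> a \<otimes> (u \<otimes> y)) \<otimes> c \<oplus> \<ominus> ((a \<otimes> u) \<otimes> (y \<otimes> c)) \<in> p"
        using p.I_r_closed[OF h1 c] p.I_l_closed[OF yc, of "a \<otimes> u"] Suc.prems(3) uR
        by (intro p.a_closed p.a_inv_closed) auto
      also have "(c \<oplus> a \<otimes> (u \<otimes> y)) \<otimes> c \<oplus> \<ominus> ((a \<otimes> u) \<otimes> (y \<otimes> c)) = c \<otimes> c"
        using c yR uR Suc.prems(3) by (simp add: l_distr m_assoc a_assoc r_neg)
      finally show ?thesis using p.I_prime c by blast
    qed
    have "a \<otimes> (u \<otimes> y) \<in> p"
    proof -
      have "\<ominus> c \<oplus> (c \<oplus> a \<otimes> (u \<otimes> y)) \<in> p"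
        by (rule p.a_closed[OF p.a_inv_closed[OF \<open>c \<in> p\<close>] h1])
      then show ?thesis using c yR uR Suc.prems(3) by (simp add: r_neg1)
    qed
    then have "a \<in> p \<or> u \<otimes> y \<in> p" using p.I_prime[of a "u \<otimes> y"] Suc.prems(3) uR yR by auto
    moreover have "a \<in> p" if "u \<otimes> y \<in> p"
    proof -
      have "inv u \<otimes> (u \<otimes> y) \<in> p" using p.I_l_closed[OF that] u(1) by blast
      then have yp: "y \<in> p" using u(1) uR yR by (simp add: m_assoc[symmetric])
      have "?B \<subseteq> p"
      proof -
        have "b i \<oplus> a \<otimes> x i \<in> p" if "i < n" for i
          using h[rule_format, of i] that by simp
        then show ?thesis using \<open>c \<in> p\<close> by auto
      qed
      then have "Idl ?B \<subseteq> p" by (rule genideal_minimal[OF p.is_ideal])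
      then have "a [^] m \<in> p" unfolding m(1) using m(2) yp p.a_closed by blast
      then show "a \<in> p" using p.pow_mem Suc.prems(3) by blast
    qed
    ultimately show "a \<in> p" by blast
  qed
qed

section \<open>Functionals and order ideals\<close>

context module begin

abbreviation dual :: "('c \<Rightarrow> 'a) set"
  where "dual \<equiv> mod_hom R M (regular_module R)"

lemma dualI:
  assumes "\<And>x. x \<in> carrier M \<Longrightarrow> \<phi> x \<in> carrier R"
    and "\<And>x y. x \<in> carrier M \<Longrightarrow> y \<in> carrier M \<Longrightarrow> \<phi> (x \<oplus>\<^bsub>M\<^esub> y) = \<phi> x \<oplus> \<phi> y"
    and "\<And>a x. a \<in> carrier R \<Longrightarrow> x \<in> carrier M \<Longrightarrow> \<phi> (a \<odot>\<^bsub>M\<^esub> x) = a \<otimes> \<phi> x"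
  shows "\<phi> \<in> dual"
  using assms by (auto simp: mod_hom_def regular_module_def)

lemma dual_closed: "\<phi> \<in> dual \<Longrightarrow> x \<in> carrier M \<Longrightarrow> \<phi> x \<in> carrier R"
  and dual_add: "\<phi> \<in> dual \<Longrightarrow> x \<in> carrier M \<Longrightarrow> y \<in> carrier M \<Longrightarrow> \<phi> (x \<oplus>\<^bsub>M\<^esub> y) = \<phi> x \<oplus> \<phi> y"
  and dual_smult: "\<phi> \<in> dual \<Longrightarrow> a \<in> carrier R \<Longrightarrow> x \<in> carrier M \<Longrightarrow> \<phi> (a \<odot>\<^bsub>M\<^esub> x) = a \<otimes> \<phi> x"
  by (auto simp: mod_hom_def regular_module_def)

lemma dual_lincomb:
  assumes "\<phi> \<in> dual" "\<psi> \<in> dual" "a \<in> carrier R" "b \<in> carrier R"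
  shows "(\<lambda>x. a \<otimes> \<phi> x \<oplus> b \<otimes> \<psi> x) \<in> dual"
  using assms
  by (intro dualI) (simp_all add: dual_closed dual_add dual_smult r_distr m_lcomm R.a_ac)

lemma dual_scale:
  assumes "\<phi> \<in> dual" "a \<in> carrier R"
  shows "(\<lambda>x. a \<otimes> \<phi> x) \<in> dual"
  using assms
  by (intro dualI) (simp_all add: dual_closed dual_add dual_smult r_distr m_lcomm)

lemma dual_zero: "(\<lambda>x. \<zero>) \<in> dual"
  by (intro dualI) simp_all

lemma dual_zero_arg: "\<phi> \<in> dual \<Longrightarrow> \<phi> \<zero>\<^bsub>M\<^esub> = \<zero>"
  using dual_smult[of \<phi> \<zero> "\<zero>\<^bsub>M\<^esub>"] by (simp add: dual_closed)

definition order_ideal :: "'c \<Rightarrow> 'a set"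
  where "order_ideal x = (\<lambda>\<phi>. \<phi> x) ` dual"

lemma order_ideal:
  assumes x: "x \<in> carrier M"
  shows "ideal (order_ideal x) R"
proof (rule idealI[OF R.ring_axioms])
  have lc: "a \<otimes> \<phi> x \<oplus> b \<otimes> \<psi> x \<in> order_ideal x"
    if "\<phi> \<in> dual" "\<psi> \<in> dual" "a \<in> carrier R" "b \<in> carrier R" for \<phi> \<psi> a b
    unfolding order_ideal_def by (rule image_eqI[OF _ dual_lincomb[OF that]]) simp
  have scale: "a \<otimes> i \<in> order_ideal x" if "i \<in> order_ideal x" "a \<in> carrier R" for a i
    using that lc[OF _ dual_zero, of _ a \<zero>] x unfolding order_ideal_def[of x]
    by (auto simp: dual_closed)
  have sub: "order_ideal x \<subseteq> carrier R"
    using x by (auto simp: order_ideal_def dual_closed)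
  show "subgroup (order_ideal x) (add_monoid R)"
  proof (rule R.add.subgroupI)
    show "order_ideal x \<subseteq> carrier R" by (rule sub)
    show "order_ideal x \<noteq> {}"
      using dual_zero by (auto simp: order_ideal_def)
  next
    fix i assume i: "i \<in> order_ideal x"
    have "(\<ominus> \<one>) \<otimes> i = \<ominus> i" using i sub by (auto simp: l_minus)
    then show "\<ominus> i \<in> order_ideal x" using scale[OF i, of "\<ominus> \<one>"] by simp
  next
    fix i j assume "i \<in> order_ideal x" "j \<in> order_ideal x"
    then obtain \<phi> \<psi> where "\<phi> \<in> dual" "\<psi> \<in> dual" "i = \<phi> x" "j = \<psi> x"
      unfolding order_ideal_def by blast
    then show "i \<oplus> j \<in> order_ideal x" using lc[of \<phi> \<psi> \<one> \<one>] x by (simp add: dual_closed)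
  qed
  show "a \<otimes> i \<in> order_ideal x" "i \<otimes> a \<in> order_ideal x"
    if "i \<in> order_ideal x" "a \<in> carrier R" for i a
    using scale[OF that] that sub R.m_comm[of i a] by auto
qed

lemma Um_iff_order_ideal:
  assumes "x \<in> carrier M"
  shows "x \<in> Um R M \<longleftrightarrow> (\<forall>p. primeideal p R \<longrightarrow> \<not> order_ideal x \<subseteq> p)"
proof -
  have "x \<in> Um R M \<longleftrightarrow> \<one> \<in> order_ideal x"
    using assms by (simp add: Um_def order_ideal_def image_iff eq_commute[of \<one>])
  moreover have "\<not> order_ideal x \<subseteq> p" if "\<one> \<in> order_ideal x" "primeideal p R" for p
    using that primeideal.one_notin by blast
  ultimately show ?thesis
    using R.ideal_eq_carrierI[OF order_ideal[OF assms]] by blast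
qed

section \<open>Dual systems\<close>

text \<open>The elements \<open>\<delta>\<close> for which some \<open>n\<close> functionals and \<open>n\<close> elements of \<open>W\<close> are dual to each
  other up to the factor \<open>\<delta>\<close>. They play the part of the minors of order \<open>n\<close> of a matrix, with
  Cramer's rule built in.\<close>

definition dual_systems :: "'c set \<Rightarrow> nat \<Rightarrow> 'a set"
  where "dual_systems W n = {\<delta> \<in> carrier R. \<exists>\<phi> y. \<forall>i<n. \<phi> i \<in> dual \<and> y i \<in> W \<and>
    (\<forall>k<n. \<phi> i (y k) = (if i = k then \<delta> else \<zero>))}"

lemma dual_systems_scale:
  assumes "\<delta> \<in> dual_systems W n" "u \<in> carrier R"
  shows "u \<otimes> \<delta> \<in> dual_systems W n"
proof -
  obtain \<phi> y where *: "\<delta> \<in> carrier R" "\<And>i. i < n \<Longrightarrow> \<phi> i \<in> dual" "\<And>i. i < n \<Longrightarrow> y i \<in> W"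
    "\<And>i k. i < n \<Longrightarrow> k < n \<Longrightarrow> \<phi> i (y k) = (if i = k then \<delta> else \<zero>)"
    using assms(1) unfolding dual_systems_def mem_Collect_eq by metis
  show ?thesis
    unfolding dual_systems_def
    by (intro CollectI conjI exI[of _ "\<lambda>i z. u \<otimes> \<phi> i z"] exI[of _ y])
      (use * assms(2) in \<open>simp_all add: dual_scale\<close>)
qed

text \<open>A matrix \<open>\<phi> i (y k)\<close> that is diagonal modulo the prime \<open>p\<close>, with diagonal entries outside
  \<open>p\<close>, becomes a scalar matrix after row operations that are invertible at \<open>p\<close>. Elimination without division clears one column after the other; it multiplies the scalar
  by the current pivot, which is outside \<open>p\<close>, and does not change the shape modulo \<open>p\<close> of the
  columns that are still to be treated.\<close>

lemma ex_dual_system_notin_prime: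
  assumes "primeideal p R" "W \<subseteq> carrier M"
    and \<phi>: "\<And>i. i < n \<Longrightarrow> \<phi> i \<in> dual" and y: "\<And>i. i < n \<Longrightarrow> y i \<in> W"
    and diag: "\<And>i k. i < n \<Longrightarrow> k < n \<Longrightarrow> \<phi> i (y k) \<in> p \<longleftrightarrow> i \<noteq> k"
  shows "\<exists>\<delta>\<in>dual_systems W n. \<delta> \<notin> p"
proof -
  interpret p: primeideal p R by (rule assms(1))
  have yM: "y i \<in> carrier M" if "i < n" for i using y[OF that] assms(2) by blast
  have step: "\<exists>\<psi> \<delta>. \<delta> \<in> carrier R - p \<and> (\<forall>i<n. \<psi> i \<in> dual) \<and>
      (\<forall>i<n. \<forall>k<m. \<psi> i (y k) = (if i = k then \<delta> else \<zero>)) \<and>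
      (\<forall>i<n. \<forall>k<n. m \<le> k \<longrightarrow> (\<psi> i (y k) \<in> p \<longleftrightarrow> i \<noteq> k))" if "m \<le> n" for m
    using that
  proof (induction m)
    case 0
    show ?case
      by (rule exI[of _ \<phi>], rule exI[of _ \<one>]) (use \<phi> diag p.one_notin in auto)
  next
    case (Suc m)
    then have m: "m < n" by simp
    from Suc.IH m obtain \<psi> \<delta> where *: "\<delta> \<in> carrier R - p" "\<forall>i<n. \<psi> i \<in> dual"
      "\<forall>i<n. \<forall>k<m. \<psi> i (y k) = (if i = k then \<delta> else \<zero>)"
      "\<forall>i<n. \<forall>k<n. m \<le> k \<longrightarrow> (\<psi> i (y k) \<in> p \<longleftrightarrow> i \<noteq> k)"
      using less_imp_le by blast
    then have \<delta>: "\<delta> \<in> carrier R" "\<delta> \<notin> p" and \<psi>: "\<And>i. i < n \<Longrightarrow> \<psi> i \<in> dual"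
      and lt: "\<And>i k. i < n \<Longrightarrow> k < m \<Longrightarrow> \<psi> i (y k) = (if i = k then \<delta> else \<zero>)"
      and ge: "\<And>i k. i < n \<Longrightarrow> k < n \<Longrightarrow> m \<le> k \<Longrightarrow> \<psi> i (y k) \<in> p \<longleftrightarrow> i \<noteq> k"
      by simp_all
    define \<pi> where "\<pi> = \<psi> m (y m)"
    have cl: "\<psi> i (y k) \<in> carrier R" if "i < n" "k < n" for i k
      using \<psi> yM that by (simp add: dual_closed)
    have \<pi>: "\<pi> \<in> carrier R" "\<pi> \<notin> p" using cl[OF m m] ge[OF m m] by (simp_all add: \<pi>_def)
    \<comment> \<open>column \<open>m\<close> is cleared with pivot \<open>\<pi>\<close>; row \<open>m\<close> is scaled so that all diagonal entries agree\<close>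
    define \<psi>' where "\<psi>' i = (if i = m then \<lambda>z. \<delta> \<otimes> \<psi> m z
      else (\<lambda>z. \<pi> \<otimes> \<psi> i z \<oplus> (\<ominus> \<psi> i (y m)) \<otimes> \<psi> m z))" for i
    have "\<pi> \<otimes> \<delta> \<in> carrier R - p" using \<pi> \<delta> p.I_prime by blast
    moreover have "\<psi>' i \<in> dual" if "i < n" for i
      using that m \<psi> \<pi> \<delta> cl unfolding \<psi>'_def by (simp add: dual_scale dual_lincomb)
    moreover have "\<psi>' i (y k) = (if i = k then \<pi> \<otimes> \<delta> else \<zero>)" if "i < n" "k < Suc m" for i k
    proof (cases "k = m")
      case True
      then show ?thesis
        using that m \<pi> \<delta> cl[OF that(1) m]
        by (auto simp: \<psi>'_def \<pi>_def[symmetric] m_comm l_minus r_minus R.r_neg)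
    next
      case False
      then have k: "k < m" "k < n" using that m by simp_all
      then show ?thesis
        using that(1) m \<pi> \<delta> cl[OF that(1) m] by (auto simp: \<psi>'_def lt)
    qed
    moreover have "\<psi>' i (y k) \<in> p \<longleftrightarrow> i \<noteq> k" if "i < n" "k < n" "Suc m \<le> k" for i k
    proof -
      have mk: "\<psi> m (y k) \<in> p" using ge[OF m that(2)] that by simp
      show ?thesis
      proof (cases "i = m")
        case True
        then show ?thesis using p.I_l_closed[OF mk \<delta>(1)] that by (simp add: \<psi>'_def)
      next
        case False
        have t: "(\<ominus> \<psi> i (y m)) \<otimes> \<psi> m (y k) \<in> p"
          using p.I_l_closed[OF mk] cl[OF that(1) m] by simp
        have eq: "\<pi> \<otimes> \<psi> i (y k) = \<psi>' i (y k) \<oplus> \<ominus> ((\<ominus> \<psi> i (y m)) \<otimes> \<psi> m (y k))"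
          using False cl that m \<pi> by (simp add: \<psi>'_def R.a_assoc R.r_neg)
        have "\<psi>' i (y k) \<in> p \<longleftrightarrow> \<pi> \<otimes> \<psi> i (y k) \<in> p"
        proof
          assume "\<psi>' i (y k) \<in> p"
          then show "\<pi> \<otimes> \<psi> i (y k) \<in> p" unfolding eq by (rule p.a_closed[OF _ p.a_inv_closed[OF t]])
        next
          assume "\<pi> \<otimes> \<psi> i (y k) \<in> p"
          then show "\<psi>' i (y k) \<in> p" using False t by (simp add: \<psi>'_def)
        qed
        also have "\<dots> \<longleftrightarrow> \<psi> i (y k) \<in> p"
          using p.I_prime[OF \<pi>(1) cl[OF that(1,2)]] \<pi> p.I_l_closed by blast
        finally show ?thesis using ge that by simp
      qed
    qed
    ultimately show ?case by blast
  qed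
  from step[OF le_refl] obtain \<psi> \<delta> where "\<delta> \<in> carrier R - p" "\<forall>i<n. \<psi> i \<in> dual"
    "\<forall>i<n. \<forall>k<n. \<psi> i (y k) = (if i = k then \<delta> else \<zero>)" by blast
  then have "\<delta> \<in> dual_systems W n" unfolding dual_systems_def using y by blast
  then show ?thesis using \<open>\<delta> \<in> carrier R - p\<close> by blast
qed

end

section \<open>Unimodular translates\<close>

text \<open>The model is a module of fractions over \<open>R = S\<^sup>-\<^sup>1 A\<close>, with \<open>T\<close> the image of \<open>A\<close> and \<open>W\<close> the
  image of an \<open>A\<close>-submodule. This is the structure that allows the coefficients of a
  translation, found over \<open>R\<close>, to be chosen without denominators.\<close>

locale translation_module = module +
  fixes T :: "'a set" and W :: "'c set"
  assumes T_subset: "T \<subseteq> carrier R"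
    and T_dense: "a \<in> carrier R \<Longrightarrow> \<exists>u\<in>Units R. u \<otimes> a \<in> T"
    and W_subset: "W \<subseteq> carrier M"
    and W_zero: "\<zero>\<^bsub>M\<^esub> \<in> W"
    and W_add: "y \<in> W \<Longrightarrow> z \<in> W \<Longrightarrow> y \<oplus>\<^bsub>M\<^esub> z \<in> W"
    and W_smult: "t \<in> T \<Longrightarrow> y \<in> W \<Longrightarrow> t \<odot>\<^bsub>M\<^esub> y \<in> W"
begin

lemma ex_prescribed_values:
  fixes n :: nat
  assumes \<delta>: "\<delta> \<in> carrier R"
    and \<phi>: "\<And>i. i < n \<Longrightarrow> \<phi> i \<in> dual" and y: "\<And>i. i < n \<Longrightarrow> y i \<in> W"
    and diag: "\<And>i k. i < n \<Longrightarrow> k < n \<Longrightarrow> \<phi> i (y k) = (if i = k then \<delta> else \<zero>)"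
    and t: "\<And>i. i < n \<Longrightarrow> t i \<in> T"
  shows "\<exists>w\<in>W. \<forall>i<n. \<phi> i w = t i \<otimes> \<delta>"
proof -
  have tR: "t i \<in> carrier R" if "i < n" for i using t[OF that] T_subset by blast
  have "\<exists>w\<in>W. \<forall>i<n. \<phi> i w = (if i < m then t i \<otimes> \<delta> else \<zero>)" if "m \<le> n" for m
    using that
  proof (induction m)
    case 0
    show ?case
      by (rule bexI[of _ "\<zero>\<^bsub>M\<^esub>"]) (simp_all add: W_zero \<phi> dual_zero_arg)
  next
    case (Suc m)
    then obtain w where w: "w \<in> W" "\<And>i. i < n \<Longrightarrow> \<phi> i w = (if i < m then t i \<otimes> \<delta> else \<zero>)"
      and m: "m < n" by auto
    let ?w = "w \<oplus>\<^bsub>M\<^esub> t m \<odot>\<^bsub>M\<^esub> y m"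
    have "\<phi> i ?w = (if i < Suc m then t i \<otimes> \<delta> else \<zero>)" if i: "i < n" for i
    proof -
      have "\<phi> i ?w = \<phi> i w \<oplus> t m \<otimes> \<phi> i (y m)"
        using \<phi>[OF i] w(1) y[OF m] W_subset tR[OF m] by (subst dual_add) (auto simp: dual_smult)
      then show ?thesis using w(2)[OF i] diag[OF i m] tR i m \<delta> by (auto simp: less_Suc_eq)
    qed
    moreover have "?w \<in> W" using W_add W_smult w(1) t[OF m] y[OF m] by blast
    ultimately show ?case by blast
  qed
  from this[OF le_refl] show ?thesis by auto
qed

text \<open>Translating \<open>x\<close> by \<open>a\<delta>w\<close>, where \<open>w\<close> is a combination of the elements of a dual
  system, changes the values of the \<open>n\<close> functionals at \<open>x\<close> by independently prescribed multiples
  of \<open>a\<delta>\<^sup>2\<close>. By Kronecker's theorem the multiples can be chosen such that a prime containing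
  the new values contains \<open>a\<delta>\<^sup>2\<close>, hence \<open>a\<delta>\<close>. The second factor \<open>\<delta>\<close> makes the translation
  itself divisible by \<open>a\<delta>\<close>, so that such a prime also contains the old order ideal whenever it
  contains the new one: nothing is lost while \<open>a\<delta>\<close> is gained.\<close>

lemma ex_correction:
  assumes dim: "no_prime_chain R {\<zero>} n"
    and a: "a \<in> carrier R" and \<delta>: "\<delta> \<in> dual_systems W n" "\<delta> \<in> T" and x: "x \<in> carrier M"
  shows "\<exists>w\<in>W. \<forall>p. primeideal p R \<longrightarrow> order_ideal (x \<oplus>\<^bsub>M\<^esub> a \<odot>\<^bsub>M\<^esub> w) \<subseteq> p \<longrightarrow>
    order_ideal x \<subseteq> p \<and> a \<otimes> \<delta> \<in> p"
proof -
  obtain \<phi> y where \<delta>R: "\<delta> \<in> carrier R" and \<phi>: "\<And>i. i < n \<Longrightarrow> \<phi> i \<in> dual"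
    and y: "\<And>i. i < n \<Longrightarrow> y i \<in> W"
    and diag: "\<And>i k. i < n \<Longrightarrow> k < n \<Longrightarrow> \<phi> i (y k) = (if i = k then \<delta> else \<zero>)"
    using \<delta>(1) unfolding dual_systems_def mem_Collect_eq by metis
  let ?a = "a \<otimes> \<delta> \<otimes> \<delta>"
  have aR: "?a \<in> carrier R" using a \<delta>R by simp
  have "\<exists>t. (\<forall>i<n. t i \<in> T) \<and> (\<forall>p. primeideal p R \<longrightarrow> {\<zero>} \<subseteq> p \<longrightarrow>
      (\<forall>i<n. \<phi> i x \<oplus> ?a \<otimes> t i \<in> p) \<longrightarrow> ?a \<in> p)"
    by (rule R.kronecker; (fact R.zeroideal dim aR T_subset T_dense | rule dual_closed[OF \<phi> x], assumption))
  then obtain t where t': "\<forall>i<n. t i \<in> T"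
    and kr: "\<forall>p. primeideal p R \<longrightarrow> {\<zero>} \<subseteq> p \<longrightarrow> (\<forall>i<n. \<phi> i x \<oplus> ?a \<otimes> t i \<in> p) \<longrightarrow> ?a \<in> p"
    by (elim exE conjE)
  then have t: "\<And>i. i < n \<Longrightarrow> t i \<in> T" by simp
  have "\<exists>w\<in>W. \<forall>i<n. \<phi> i w = t i \<otimes> \<delta>"
    by (rule ex_prescribed_values; fact)
  then obtain w where w: "w \<in> W" "\<And>i. i < n \<Longrightarrow> \<phi> i w = t i \<otimes> \<delta>"
    by meson
  have wM: "w \<in> carrier M" using w W_subset by blast
  let ?x = "x \<oplus>\<^bsub>M\<^esub> a \<odot>\<^bsub>M\<^esub> (\<delta> \<odot>\<^bsub>M\<^esub> w)"
  have val: "\<psi> ?x = \<psi> x \<oplus> a \<otimes> \<delta> \<otimes> \<psi> w" if "\<psi> \<in> dual" for \<psi>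
    using that x wM a \<delta>R by (simp add: dual_add dual_smult dual_closed m_assoc)
  have "order_ideal x \<subseteq> p \<and> a \<otimes> \<delta> \<in> p" if p: "primeideal p R" "order_ideal ?x \<subseteq> p" for p
  proof -
    interpret p: primeideal p R by (rule p(1))
    have mem: "\<psi> ?x \<in> p" if "\<psi> \<in> dual" for \<psi> using that p(2) by (auto simp: order_ideal_def)
    have "\<phi> i x \<oplus> ?a \<otimes> t i \<in> p" if i: "i < n" for i
    proof -
      have "t i \<in> carrier R" using t[OF i] T_subset by blast
      then have "a \<otimes> \<delta> \<otimes> \<phi> i w = ?a \<otimes> t i" using w(2)[OF i] a \<delta>R by (simp add: m_ac)
      then show ?thesis using mem[OF \<phi>[OF i]] val[OF \<phi>[OF i]] by simp
    qed
    then have "?a \<in> p" using kr p(1) by simp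
    then have ad: "a \<otimes> \<delta> \<in> p"
      using p.I_prime[of "a \<otimes> \<delta>" \<delta>] p.I_l_closed[of \<delta> a] a \<delta>R by auto
    have "\<psi> x \<in> p" if \<psi>: "\<psi> \<in> dual" for \<psi>
    proof -
      have c: "\<psi> x \<in> carrier R" "\<psi> w \<in> carrier R" using \<psi> x wM by (simp_all add: dual_closed)
      have "\<psi> ?x \<oplus> \<ominus> (a \<otimes> \<delta> \<otimes> \<psi> w) \<in> p"
        by (rule p.a_closed[OF mem[OF \<psi>] p.a_inv_closed[OF p.I_r_closed[OF ad c(2)]]])
      then show ?thesis unfolding val[OF \<psi>] using c a \<delta>R by (simp add: R.a_assoc R.r_neg)
    qed
    then show ?thesis using ad by (auto simp: order_ideal_def)
  qed
  moreover have "\<delta> \<odot>\<^bsub>M\<^esub> w \<in> W" by (rule W_smult[OF \<delta>(2) w(1)])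
  ultimately show ?thesis by (intro bexI[of _ "\<delta> \<odot>\<^bsub>M\<^esub> w"]) simp_all
qed

text \<open>The steps above compose, since the set \<open>E\<close> of all \<open>e\<close> for which \<open>ae\<close> can be gained from every
  starting point is an ideal: to gain \<open>a(e + f)\<close>, first gain \<open>ae\<close> and then, from the new point,
  \<open>af\<close>. By the hypothesis on dual systems no prime contains both \<open>E\<close> and the order ideal of
  \<open>x\<close>, so \<open>\<one> = o' + e\<close> with \<open>o'\<close> in the order ideal and \<open>e \<in> E\<close>. Once \<open>ae\<close> is gained, a
  prime containing the new order ideal contains \<open>ao'\<close> and \<open>ae\<close>, hence \<open>a\<close>, and it contains the
  order ideal of \<open>x\<close> as well.\<close>

theorem ex_unimodular_translate:
  assumes dim: "no_prime_chain R {\<zero>} n"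
    and a: "a \<in> carrier R" and x: "x \<in> carrier M"
    and unimod: "\<And>p. primeideal p R \<Longrightarrow> order_ideal x \<subseteq> p \<Longrightarrow> a \<notin> p"
    and sys: "\<And>p. primeideal p R \<Longrightarrow> order_ideal x \<subseteq> p \<Longrightarrow> \<not> dual_systems W n \<subseteq> p"
  shows "\<exists>w\<in>W. x \<oplus>\<^bsub>M\<^esub> a \<odot>\<^bsub>M\<^esub> w \<in> Um R M"
proof -
  define corr where "corr e x w \<longleftrightarrow> (\<forall>p. primeideal p R \<longrightarrow>
    order_ideal (x \<oplus>\<^bsub>M\<^esub> a \<odot>\<^bsub>M\<^esub> w) \<subseteq> p \<longrightarrow> order_ideal x \<subseteq> p \<and> a \<otimes> e \<in> p)" for e x w
  \<comment> \<open>the quantifier over all starting points is what makes \<open>E\<close> closed under addition\<close>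
  define E where "E = {e \<in> carrier R. \<forall>x\<in>carrier M. \<exists>w\<in>W. corr e x w}"
  have scale: "r \<otimes> e \<in> E" if "e \<in> E" "r \<in> carrier R" for e r
  proof -
    have e: "e \<in> carrier R" using that by (simp add: E_def)
    have "corr (r \<otimes> e) x w" if c: "corr e x w" for x w
      unfolding corr_def
    proof (intro allI impI)
      fix p assume p: "primeideal p R" "order_ideal (x \<oplus>\<^bsub>M\<^esub> a \<odot>\<^bsub>M\<^esub> w) \<subseteq> p"
      with c have "order_ideal x \<subseteq> p" "a \<otimes> e \<in> p" unfolding corr_def by blast+
      moreover have "a \<otimes> (r \<otimes> e) = r \<otimes> (a \<otimes> e)"
        using a e \<open>r \<in> carrier R\<close> by (simp add: m_lcomm)
      ultimately show "order_ideal x \<subseteq> p \<and> a \<otimes> (r \<otimes> e) \<in> p"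
        using ideal.I_l_closed[OF primeideal.axioms(1)[OF p(1)]] \<open>r \<in> carrier R\<close> by simp
    qed
    then show ?thesis using that e unfolding E_def by blast
  qed
  have Eid: "ideal E R"
  proof (rule idealI[OF R.ring_axioms])
    show "subgroup E (add_monoid R)"
    proof (rule R.add.subgroupI)
      show "E \<subseteq> carrier R" by (auto simp: E_def)
      have "\<zero> \<in> p" if "primeideal p R" for p
        using that additive_subgroup.zero_closed ideal.axioms(1) primeideal.axioms(1) by blast
      then have "corr \<zero> x \<zero>\<^bsub>M\<^esub>" if "x \<in> carrier M" for x
        unfolding corr_def using that a by simp
      then have "\<zero> \<in> E" using W_zero by (auto simp: E_def)
      then show "E \<noteq> {}" by blast
    next
      fix e assume e: "e \<in> E"
      then have "(\<ominus> \<one>) \<otimes> e = \<ominus> e" by (simp add: E_def l_minus)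
      then show "\<ominus> e \<in> E" using scale[OF e, of "\<ominus> \<one>"] by simp
    next
      fix e f assume ef: "e \<in> E" "f \<in> E"
      then have eR: "e \<in> carrier R" "f \<in> carrier R" by (simp_all add: E_def)
      have "\<exists>w\<in>W. corr (e \<oplus> f) x w" if x: "x \<in> carrier M" for x
      proof -
        obtain v where v: "v \<in> W" "corr e x v" using ef x by (auto simp: E_def)
        then have vM: "v \<in> carrier M" using W_subset by blast
        then have "x \<oplus>\<^bsub>M\<^esub> a \<odot>\<^bsub>M\<^esub> v \<in> carrier M" using x a by simp
        then obtain w where w: "w \<in> W" "corr f (x \<oplus>\<^bsub>M\<^esub> a \<odot>\<^bsub>M\<^esub> v) w" using ef by (auto simp: E_def)
        then have wM: "w \<in> carrier M" using W_subset by blast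
        have eq: "x \<oplus>\<^bsub>M\<^esub> a \<odot>\<^bsub>M\<^esub> (v \<oplus>\<^bsub>M\<^esub> w) = x \<oplus>\<^bsub>M\<^esub> a \<odot>\<^bsub>M\<^esub> v \<oplus>\<^bsub>M\<^esub> a \<odot>\<^bsub>M\<^esub> w"
          using x a vM wM by (simp add: smult_r_distr M.a_assoc)
        have "corr (e \<oplus> f) x (v \<oplus>\<^bsub>M\<^esub> w)"
          unfolding corr_def eq
        proof (intro allI impI)
          fix p assume p: "primeideal p R"
            "order_ideal (x \<oplus>\<^bsub>M\<^esub> a \<odot>\<^bsub>M\<^esub> v \<oplus>\<^bsub>M\<^esub> a \<odot>\<^bsub>M\<^esub> w) \<subseteq> p"
          interpret p: primeideal p R by (rule p(1))
          have "order_ideal (x \<oplus>\<^bsub>M\<^esub> a \<odot>\<^bsub>M\<^esub> v) \<subseteq> p" "a \<otimes> f \<in> p"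
            using w(2) p unfolding corr_def by blast+
          moreover from this have "order_ideal x \<subseteq> p" "a \<otimes> e \<in> p"
            using v(2) p(1) unfolding corr_def by blast+
          ultimately show "order_ideal x \<subseteq> p \<and> a \<otimes> (e \<oplus> f) \<in> p"
            using a eR by (simp add: r_distr)
        qed
        then show ?thesis using W_add v(1) w(1) by blast
      qed
      then show "e \<oplus> f \<in> E" using eR by (simp add: E_def)
    qed
    fix e r assume er: "e \<in> E" "r \<in> carrier R"
    show "r \<otimes> e \<in> E" by (rule scale[OF er])
    moreover have "r \<otimes> e = e \<otimes> r" using er by (simp add: E_def m_comm)
    ultimately show "e \<otimes> r \<in> E" by simp
  qed
  have sysE: "\<delta> \<in> E" if "\<delta> \<in> dual_systems W n" "\<delta> \<in> T" for \<delta>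
    using ex_correction[OF dim a that] T_subset that(2) unfolding E_def corr_def by blast
  have Oid: "ideal (order_ideal x) R" by (rule order_ideal[OF x])
  note sup = R.set_add_supersets[OF Oid Eid]
  have "\<one> \<in> order_ideal x <+>\<^bsub>R\<^esub> E"
  proof (rule R.ideal_eq_carrierI[OF R.add_ideals[OF Oid Eid]])
    fix p assume p: "primeideal p R"
    interpret p: primeideal p R by (rule p)
    show "\<not> order_ideal x <+>\<^bsub>R\<^esub> E \<subseteq> p"
    proof
      assume "order_ideal x <+>\<^bsub>R\<^esub> E \<subseteq> p"
      with sup have sub: "order_ideal x \<subseteq> p" "E \<subseteq> p" by blast+
      obtain \<delta> where \<delta>: "\<delta> \<in> dual_systems W n" "\<delta> \<notin> p" using sys[OF p sub(1)] by blast
      then have \<delta>R: "\<delta> \<in> carrier R" by (simp add: dual_systems_def)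
      obtain u where u: "u \<in> Units R" "u \<otimes> \<delta> \<in> T" using T_dense[OF \<delta>R] by blast
      have uR: "u \<in> carrier R" using u by blast
      have "u \<otimes> \<delta> \<in> p"
        using sysE[OF dual_systems_scale[OF \<delta>(1) uR] u(2)] sub by blast
      then have "inv u \<otimes> (u \<otimes> \<delta>) \<in> p" using p.I_l_closed u(1) by blast
      then show False using \<delta>(2) u(1) uR \<delta>R by (simp add: m_assoc[symmetric])
    qed
  qed
  then obtain o' e where oe: "o' \<in> order_ideal x" "e \<in> E" "\<one> = o' \<oplus> e"
    unfolding set_add_def' by blast
  obtain w where w: "w \<in> W" "corr e x w" using oe(2) x by (auto simp: E_def)
  have wM: "w \<in> carrier M" using w W_subset by blast
  have "\<not> order_ideal (x \<oplus>\<^bsub>M\<^esub> a \<odot>\<^bsub>M\<^esub> w) \<subseteq> p" if p: "primeideal p R" for p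
  proof
    interpret p: primeideal p R by (rule p)
    assume "order_ideal (x \<oplus>\<^bsub>M\<^esub> a \<odot>\<^bsub>M\<^esub> w) \<subseteq> p"
    then have h: "order_ideal x \<subseteq> p" "a \<otimes> e \<in> p" using w(2) p unfolding corr_def by blast+
    have c: "o' \<in> carrier R" "e \<in> carrier R"
      using oe ideal.Icarr[OF Oid] ideal.Icarr[OF Eid] by blast+
    have "a \<otimes> o' \<oplus> a \<otimes> e \<in> p"
      using p.a_closed p.I_l_closed[of o' a] h oe(1) a by blast
    also have "a \<otimes> o' \<oplus> a \<otimes> e = a"
      using a c by (simp add: r_distr[symmetric] oe(3)[symmetric])
    finally show False using unimod[OF p h(1)] by blast
  qed
  then have "x \<oplus>\<^bsub>M\<^esub> a \<odot>\<^bsub>M\<^esub> w \<in> Um R M"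
    using Um_iff_order_ideal x a wM by simp
  then show ?thesis using w(1) by blast
qed

end

section \<open>Bases at a prime lift to functionals\<close>

lemma (in cring) fraction_carrier:
  "x \<in> carrier R \<Longrightarrow> s \<in> S \<Longrightarrow> fraction R S (regular_module R) x s \<in> carrier (loc_ring R S)"
  by (auto simp: loc_ring_def loc_module_def regular_module_def)

lemma (in cring) loc_ring_carrierE:
  assumes "X \<in> carrier (loc_ring R S)"
  obtains x s where "X = fraction R S (regular_module R) x s" "x \<in> carrier R" "s \<in> S"
  using assms by (auto simp: loc_ring_def loc_module_def regular_module_def)

lemma (in cring) loc_ring_add_fraction:
  assumes "submonoid S R" "x \<in> carrier R" "s \<in> S" "y \<in> carrier R" "t \<in> S"
  shows "fraction R S (regular_module R) x s \<oplus>\<^bsub>loc_ring R S\<^esub> fraction R S (regular_module R) y t =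
    fraction R S (regular_module R) (t \<otimes> x \<oplus> s \<otimes> y) (s \<otimes> t)"
  using localization.add_fraction[OF localization_regular[OF assms(1)], of x s y t] assms(2-)
  by (simp add: loc_ring_def regular_module_def)

lemma (in cring) loc_ring_mult_fraction:
  assumes "submonoid S R" "x \<in> carrier R" "s \<in> S" "y \<in> carrier R" "t \<in> S"
  shows "fraction R S (regular_module R) x s \<otimes>\<^bsub>loc_ring R S\<^esub> fraction R S (regular_module R) y t =
    fraction R S (regular_module R) (x \<otimes> y) (s \<otimes> t)"
  using localization.mult_fraction[OF localization_regular[OF assms(1)]] assms(2-) by simp

lemma (in cring) loc_ring_fraction_eq_iff:
  assumes "submonoid S R" "x \<in> carrier R" "s \<in> S" "y \<in> carrier R" "t \<in> S"
  shows "fraction R S (regular_module R) x s = fraction R S (regular_module R) y t \<longleftrightarrow>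
    (\<exists>u\<in>S. u \<otimes> (t \<otimes> x) = u \<otimes> (s \<otimes> y))"
  using localization.fraction_eq_iff[OF localization_regular[OF assms(1)], of x s y t] assms(2-)
  by (simp add: regular_module_def)

text \<open>A homomorphism from a free module to the ring of fractions comes, up to a common denominator
  \<open>t\<close>, from a functional over \<open>R\<close>, as long as only finitely many coordinates matter. The
  induction adds one coordinate \<open>j\<close> at a time and sets it to zero before using the functional
  already found, so that the coordinate is not counted twice.\<close>

lemma (in cring) ex_dual_lift_free:
  fixes I :: "'i set" and S :: "'a set" and G :: "('i \<Rightarrow> 'a) \<Rightarrow> ('a \<times> 'a) set"
  defines "F \<equiv> free_module R I" and "q \<equiv> fraction R S (regular_module R)" and "L \<equiv> loc_ring R S"
  assumes S: "submonoid S R" and J: "finite J" "J \<subseteq> I"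
    and G: "\<And>v. v \<in> carrier F \<Longrightarrow> G v \<in> carrier L"
      "\<And>v w. v \<in> carrier F \<Longrightarrow> w \<in> carrier F \<Longrightarrow> G (v \<oplus>\<^bsub>F\<^esub> w) = G v \<oplus>\<^bsub>L\<^esub> G w"
      "\<And>a v. a \<in> carrier R \<Longrightarrow> v \<in> carrier F \<Longrightarrow> G (a \<odot>\<^bsub>F\<^esub> v) = q a \<one> \<otimes>\<^bsub>L\<^esub> G v"
  shows "\<exists>t\<in>S. \<exists>\<Psi>\<in>mod_hom R F (regular_module R).
    \<forall>v\<in>carrier F. (\<forall>i. v i \<noteq> \<zero> \<longrightarrow> i \<in> J) \<longrightarrow> G v = q (\<Psi> v) t"
  using J
proof (induction J)
  case empty
  have S1: "\<one> \<in> S" and SR: "S \<subseteq> carrier R" using S by (auto simp: submonoid_def)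
  have zF: "(\<lambda>i. \<zero>) \<in> carrier F" by (simp add: F_def free_module_def)
  have "G (\<lambda>i. \<zero>) = q \<zero> \<one>"
  proof -
    obtain c s where c: "G (\<lambda>i. \<zero>) = q c s" "c \<in> carrier R" "s \<in> S"
      using loc_ring_carrierE[OF G(1)[OF zF, unfolded L_def]] unfolding q_def by blast
    have "\<zero> \<odot>\<^bsub>F\<^esub> (\<lambda>i. \<zero>) = (\<lambda>i. \<zero>)" by (simp add: F_def free_module_def)
    then have "G (\<lambda>i. \<zero>) = q \<zero> \<one> \<otimes>\<^bsub>L\<^esub> q c s"
      using G(3)[OF zero_closed zF] c(1) by simp
    also have "\<dots> = q \<zero> s"
      using c S1 SR loc_ring_mult_fraction[OF S, of \<zero> \<one> c s] by (auto simp: q_def L_def)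
    also have "\<dots> = q \<zero> \<one>"
      unfolding q_def using c S1 SR by (subst loc_ring_fraction_eq_iff[OF S]) (auto intro: bexI[of _ \<one>] simp: subsetD)
    finally show ?thesis .
  qed
  moreover have "v = (\<lambda>i. \<zero>)" if "\<forall>i. v i \<noteq> \<zero> \<longrightarrow> i \<in> {}" for v :: "'i \<Rightarrow> 'a"
    using that by auto
  moreover have "(\<lambda>v. \<zero>) \<in> mod_hom R F (regular_module R)"
    by (simp add: mod_hom_def regular_module_def)
  ultimately show ?case
    using S1 by (intro bexI[of _ \<one>] bexI[of _ "\<lambda>v. \<zero>"] ballI impI) metis+
next
  case (insert j J)
  have S1: "\<one> \<in> S" and SR: "S \<subseteq> carrier R" and SS: "\<And>s t. s \<in> S \<Longrightarrow> t \<in> S \<Longrightarrow> s \<otimes> t \<in> S"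
    using S by (auto simp: submonoid_def)
  from insert obtain t \<Psi> where t: "t \<in> S" and \<Psi>: "\<Psi> \<in> mod_hom R F (regular_module R)"
    and IH: "\<And>v. v \<in> carrier F \<Longrightarrow> \<forall>i. v i \<noteq> \<zero> \<longrightarrow> i \<in> J \<Longrightarrow> G v = q (\<Psi> v) t"
    by auto
  define e where "e = (\<lambda>i. if i = j then \<one> else \<zero>)"
  have eF: "e \<in> carrier F"
    using insert.prems by (auto simp: e_def F_def free_module_def)
  obtain c s where c: "G e = q c s" "c \<in> carrier R" "s \<in> S"
    using loc_ring_carrierE[OF G(1)[OF eF, unfolded L_def]] unfolding q_def by blast
  have cut: "v(j := \<zero>) \<in> carrier F" if "v \<in> carrier F" for v
    using that by (auto simp: F_def free_module_def elim: rev_finite_subset)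
  have vj: "v j \<in> carrier R" if "v \<in> carrier F" for v
    using that insert.prems by (auto simp: F_def free_module_def)
  have FR: "v i \<in> carrier R" if "v \<in> carrier F" for v i
    using that by (cases "i \<in> I") (auto simp: F_def free_module_def)
  define \<Psi>' where "\<Psi>' v = s \<otimes> \<Psi> (v(j := \<zero>)) \<oplus> t \<otimes> (v j \<otimes> c)" for v
  have \<Psi>R: "\<Psi> v \<in> carrier R" if "v \<in> carrier F" for v
    using \<Psi> that by (auto simp: mod_hom_def regular_module_def)
  have "\<Psi>' \<in> mod_hom R F (regular_module R)"
  proof -
    have "\<Psi>' v \<in> carrier R" if "v \<in> carrier F" for v
      using \<Psi>R[OF cut[OF that]] vj[OF that] c t SR by (auto simp: \<Psi>'_def)
    moreover have "\<Psi>' (v \<oplus>\<^bsub>F\<^esub> w) = \<Psi>' v \<oplus> \<Psi>' w" if v: "v \<in> carrier F" and w: "w \<in> carrier F" for v w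
    proof -
      have "(v \<oplus>\<^bsub>F\<^esub> w)(j := \<zero>) = v(j := \<zero>) \<oplus>\<^bsub>F\<^esub> w(j := \<zero>)"
        by (auto simp: F_def free_module_def)
      then have "\<Psi> ((v \<oplus>\<^bsub>F\<^esub> w)(j := \<zero>)) = \<Psi> (v(j := \<zero>)) \<oplus> \<Psi> (w(j := \<zero>))"
        using \<Psi> cut[OF v] cut[OF w] by (simp add: mod_hom_def regular_module_def)
      moreover have "(v \<oplus>\<^bsub>F\<^esub> w) j = v j \<oplus> w j" by (simp add: F_def free_module_def)
      ultimately show ?thesis
        using \<Psi>R cut v w vj c t SR subsetD[OF SR] by (simp add: \<Psi>'_def r_distr l_distr a_ac)
    qed
    moreover have "\<Psi>' (a \<odot>\<^bsub>F\<^esub> v) = a \<otimes> \<Psi>' v" if a: "a \<in> carrier R" and v: "v \<in> carrier F" for a v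
    proof -
      have "(a \<odot>\<^bsub>F\<^esub> v)(j := \<zero>) = a \<odot>\<^bsub>F\<^esub> v(j := \<zero>)"
        using a by (auto simp: F_def free_module_def)
      then have "\<Psi> ((a \<odot>\<^bsub>F\<^esub> v)(j := \<zero>)) = a \<otimes> \<Psi> (v(j := \<zero>))"
        using \<Psi> cut[OF v] a by (simp add: mod_hom_def regular_module_def)
      moreover have "(a \<odot>\<^bsub>F\<^esub> v) j = a \<otimes> v j" by (simp add: F_def free_module_def)
      ultimately show ?thesis
        using \<Psi>R cut a v vj c t subsetD[OF SR] by (simp add: \<Psi>'_def r_distr m_ac)
    qed
    ultimately show ?thesis by (auto simp: mod_hom_def regular_module_def)
  qed
  moreover have "G v = q (\<Psi>' v) (t \<otimes> s)"
    if v: "v \<in> carrier F" and supp: "\<forall>i. v i \<noteq> \<zero> \<longrightarrow> i \<in> insert j J" for v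
  proof -
    have "v = v(j := \<zero>) \<oplus>\<^bsub>F\<^esub> (v j \<odot>\<^bsub>F\<^esub> e)"
      using FR[OF v] by (auto simp: F_def free_module_def e_def)
    moreover have "v j \<odot>\<^bsub>F\<^esub> e \<in> carrier F"
      using vj[OF v] insert.prems by (auto simp: F_def free_module_def e_def)
    ultimately have "G v = G (v(j := \<zero>)) \<oplus>\<^bsub>L\<^esub> (q (v j) \<one> \<otimes>\<^bsub>L\<^esub> G e)"
      using G(2)[OF cut[OF v]] G(3)[OF vj[OF v] eF] by metis
    also have "G (v(j := \<zero>)) = q (\<Psi> (v(j := \<zero>))) t"
      using supp by (intro IH cut v) auto
    also have "q (v j) \<one> \<otimes>\<^bsub>L\<^esub> G e = q (v j \<otimes> c) s"
      using loc_ring_mult_fraction[OF S vj[OF v] S1 c(2,3)] c subsetD[OF SR]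
      by (simp add: q_def L_def)
    also have "q (\<Psi> (v(j := \<zero>))) t \<oplus>\<^bsub>L\<^esub> q (v j \<otimes> c) s = q (\<Psi>' v) (t \<otimes> s)"
      unfolding q_def L_def \<Psi>'_def
      using vj[OF v] c(2,3) \<Psi>R[OF cut[OF v]] t by (intro loc_ring_add_fraction[OF S]) auto
    finally show ?thesis .
  qed
  ultimately show ?case using SS[OF t c(3)] by blast
qed

text \<open>Stated through submodules instead of linear combinations, since preimages of submodules
  make this form pass easily to modules of fractions.\<close>

definition (in module) generates :: "'c set \<Rightarrow> bool"
  where "generates X \<longleftrightarrow> X \<subseteq> carrier M \<and> (\<forall>H. submodule H R M \<longrightarrow> X \<subseteq> H \<longrightarrow> H = carrier M)"

text \<open>A dual basis in disguise: \<open>\<alpha>\<close> collects the coordinate functionals and \<open>\<beta>\<close> sends the unit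
  vectors to generators. The coordinates in use form a finite set since the elements all of
  whose coordinates outside \<open>J\<close> vanish form a submodule; it suffices that \<open>J\<close> contains the
  supports of the generators.\<close>

lemma (in module) fg_projective_retract:
  assumes proj: "projective R M" and X: "finite X" "generates X"
  shows "\<exists>(I :: 'c set) J \<alpha> \<beta>. finite J \<and> J \<subseteq> I \<and>
    \<alpha> \<in> mod_hom R M (free_module R I) \<and> \<beta> \<in> mod_hom R (free_module R I) M \<and>
    (\<forall>z\<in>carrier M. \<beta> (\<alpha> z) = z \<and> (\<forall>i. \<alpha> z i \<noteq> \<zero> \<longrightarrow> i \<in> J))"
proof -
  obtain I :: "'c set" and N :: "('a, 'c \<Rightarrow> 'a) module" and f
    where N: "module R N" and f: "f \<in> mod_hom R (direct_sum M N) (free_module R I)"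
      and bij: "bij_betw f (carrier (direct_sum M N)) (carrier (free_module R I))"
    using proj unfolding projective_def mod_isomorphic_def by blast
  interpret N: module R N by (rule N)
  define D where "D = direct_sum M N"
  define F where "F = free_module R I"
  note f = f[folded D_def F_def] and bij = bij[folded D_def F_def]
  have D: "carrier D = carrier M \<times> carrier N"
    "(x, y) \<oplus>\<^bsub>D\<^esub> (x', y') = (x \<oplus>\<^bsub>M\<^esub> x', y \<oplus>\<^bsub>N\<^esub> y')"
    "a \<odot>\<^bsub>D\<^esub> (x, y) = (a \<odot>\<^bsub>M\<^esub> x, a \<odot>\<^bsub>N\<^esub> y)" for a x y x' y'
    by (simp_all add: D_def direct_sum_def)
  define \<alpha> where "\<alpha> z = f (z, \<zero>\<^bsub>N\<^esub>)" for z
  define g where "g = inv_into (carrier D) f"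
  define \<beta> where "\<beta> v = fst (g v)" for v
  have gf: "g (f d) = d" if "d \<in> carrier D" for d
    using bij that by (simp add: g_def bij_betw_def)
  have fg: "f (g v) = v" "g v \<in> carrier D" if "v \<in> carrier F" for v
    using bij that by (auto simp: g_def bij_betw_def f_inv_into_f inv_into_into)
  have fadd: "f (d \<oplus>\<^bsub>D\<^esub> d') = f d \<oplus>\<^bsub>F\<^esub> f d'" if "d \<in> carrier D" "d' \<in> carrier D" for d d'
    using f that by (simp add: mod_hom_def)
  have fsm: "f (a \<odot>\<^bsub>D\<^esub> d) = a \<odot>\<^bsub>F\<^esub> f d" if "a \<in> carrier R" "d \<in> carrier D" for a d
    using f that by (simp add: mod_hom_def)
  have fF: "f d \<in> carrier F" if "d \<in> carrier D" for d
    using f that by (auto simp: mod_hom_def)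
  have \<alpha>: "\<alpha> \<in> mod_hom R M F"
  proof -
    have "\<alpha> z \<in> carrier F" if "z \<in> carrier M" for z
      using that by (simp add: \<alpha>_def fF D)
    moreover have "\<alpha> (y \<oplus>\<^bsub>M\<^esub> z) = \<alpha> y \<oplus>\<^bsub>F\<^esub> \<alpha> z" if "y \<in> carrier M" "z \<in> carrier M" for y z
      using that fadd[of "(y, \<zero>\<^bsub>N\<^esub>)" "(z, \<zero>\<^bsub>N\<^esub>)"] by (simp add: \<alpha>_def D)
    moreover have "\<alpha> (a \<odot>\<^bsub>M\<^esub> z) = a \<odot>\<^bsub>F\<^esub> \<alpha> z" if "a \<in> carrier R" "z \<in> carrier M" for a z
      using that fsm[of a "(z, \<zero>\<^bsub>N\<^esub>)"] by (simp add: \<alpha>_def D)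
    ultimately show ?thesis by (simp add: mod_hom_def)
  qed
  have \<beta>: "\<beta> \<in> mod_hom R F M"
  proof -
    have "\<beta> v \<in> carrier M" if "v \<in> carrier F" for v
      using fg(2)[OF that] by (auto simp: \<beta>_def D)
    moreover have "\<beta> (v \<oplus>\<^bsub>F\<^esub> w) = \<beta> v \<oplus>\<^bsub>M\<^esub> \<beta> w" if v: "v \<in> carrier F" "w \<in> carrier F" for v w
    proof -
      obtain a b c d where ab: "g v = (a, b)" "g w = (c, d)" by fastforce
      then have m: "a \<in> carrier M" "b \<in> carrier N" "c \<in> carrier M" "d \<in> carrier N"
        using fg(2)[OF v(1)] fg(2)[OF v(2)] by (simp_all add: D)
      have "v \<oplus>\<^bsub>F\<^esub> w = f (g v \<oplus>\<^bsub>D\<^esub> g w)" using fadd fg v by simp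
      then have "g (v \<oplus>\<^bsub>F\<^esub> w) = g v \<oplus>\<^bsub>D\<^esub> g w"
        using gf[of "g v \<oplus>\<^bsub>D\<^esub> g w"] ab m by (simp add: D)
      then show ?thesis using ab by (simp add: \<beta>_def D)
    qed
    moreover have "\<beta> (a \<odot>\<^bsub>F\<^esub> v) = a \<odot>\<^bsub>M\<^esub> \<beta> v" if v: "a \<in> carrier R" "v \<in> carrier F" for a v
    proof -
      obtain b c where ab: "g v = (b, c)" by fastforce
      then have m: "b \<in> carrier M" "c \<in> carrier N"
        using fg(2)[OF v(2)] by (simp_all add: D)
      have "a \<odot>\<^bsub>F\<^esub> v = f (a \<odot>\<^bsub>D\<^esub> g v)" using fsm fg v by simp
      then have "g (a \<odot>\<^bsub>F\<^esub> v) = a \<odot>\<^bsub>D\<^esub> g v"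
        using gf[of "a \<odot>\<^bsub>D\<^esub> g v"] ab m v by (simp add: D)
      then show ?thesis using ab by (simp add: \<beta>_def D)
    qed
    ultimately show ?thesis by (simp add: mod_hom_def)
  qed
  have \<beta>\<alpha>: "\<beta> (\<alpha> z) = z" if "z \<in> carrier M" for z
    using gf[of "(z, \<zero>\<^bsub>N\<^esub>)"] that by (simp add: \<beta>_def \<alpha>_def D)
  define J where "J = (\<Union>z\<in>X. {i \<in> I. \<alpha> z i \<noteq> \<zero>})"
  have XM: "X \<subseteq> carrier M" using X(2) unfolding generates_def by blast
  have \<alpha>F: "\<alpha> z \<in> carrier F" if "z \<in> carrier M" for z
    using \<alpha> that by (auto simp: mod_hom_def)
  have Jfin: "finite J"
    unfolding J_def using X(1) \<alpha>F XM by (auto simp: F_def free_module_def)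
  have \<alpha>R: "\<alpha> z i \<in> carrier R" if "z \<in> carrier M" for z i
    using \<alpha>F[OF that] by (cases "i \<in> I") (auto simp: F_def free_module_def)
  have \<alpha>0: "\<alpha> z i = \<zero>" if "z \<in> carrier M" "i \<notin> I" for z i
    using \<alpha>F[OF that(1)] that(2) by (auto simp: F_def free_module_def)
  have \<alpha>add: "\<alpha> (y \<oplus>\<^bsub>M\<^esub> z) i = \<alpha> y i \<oplus> \<alpha> z i" if "y \<in> carrier M" "z \<in> carrier M" for y z i
    using \<alpha> that by (auto simp: mod_hom_def F_def free_module_def)
  have \<alpha>sm: "\<alpha> (a \<odot>\<^bsub>M\<^esub> z) i = a \<otimes> \<alpha> z i" if "a \<in> carrier R" "z \<in> carrier M" for a z i
    using \<alpha> that by (auto simp: mod_hom_def F_def free_module_def)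
  have \<alpha>z: "\<alpha> \<zero>\<^bsub>M\<^esub> i = \<zero>" for i
    using \<alpha>sm[OF R.zero_closed M.zero_closed, of i] \<alpha>R[OF M.zero_closed, of i] by simp
  let ?H = "{z \<in> carrier M. \<forall>i. i \<notin> J \<longrightarrow> \<alpha> z i = \<zero>}"
  have "submodule ?H R M"
  proof (rule submoduleI)
    fix z assume z: "z \<in> ?H"
    then have "\<ominus>\<^bsub>M\<^esub> z = (\<ominus> \<one>) \<odot>\<^bsub>M\<^esub> z" by (simp add: smult_l_minus)
    then have "\<alpha> (\<ominus>\<^bsub>M\<^esub> z) i = (\<ominus> \<one>) \<otimes> \<alpha> z i" for i
      using \<alpha>sm[of "\<ominus> \<one>" z] z by simp
    then show "\<ominus>\<^bsub>M\<^esub> z \<in> ?H" using z by simp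
  next
    show "?H \<subseteq> carrier M" by blast
    show "\<zero>\<^bsub>M\<^esub> \<in> ?H" by (simp add: \<alpha>z)
    show "y \<oplus>\<^bsub>M\<^esub> z \<in> ?H" if "y \<in> ?H" "z \<in> ?H" for y z
      using that by (simp add: \<alpha>add)
    show "a \<odot>\<^bsub>M\<^esub> z \<in> ?H" if "a \<in> carrier R" "z \<in> ?H" for a z
      using that by (simp add: \<alpha>sm)
  qed
  moreover have "X \<subseteq> ?H"
  proof
    fix z assume z: "z \<in> X"
    then have zM: "z \<in> carrier M" using XM by blast
    have "\<alpha> z i = \<zero>" if "i \<notin> J" for i
      using that z \<alpha>0[OF zM, of i] unfolding J_def by blast
    with zM show "z \<in> ?H" by simp
  qed
  ultimately have H: "?H = carrier M"
    by (rule X(2)[unfolded generates_def, THEN conjunct2, rule_format])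
  have "i \<in> J" if "z \<in> carrier M" "\<alpha> z i \<noteq> \<zero>" for z i
  proof (rule ccontr)
    assume "i \<notin> J"
    moreover have "z \<in> ?H" using that(1) by (subst H)
    ultimately show False using that(2) by simp
  qed
  then have "\<forall>z\<in>carrier M. \<beta> (\<alpha> z) = z \<and> (\<forall>i. \<alpha> z i \<noteq> \<zero> \<longrightarrow> i \<in> J)"
    using \<beta>\<alpha> by simp
  moreover have "J \<subseteq> I" by (auto simp: J_def)
  ultimately show ?thesis
    using Jfin \<alpha>[unfolded F_def] \<beta>[unfolded F_def] by (intro exI conjI)
qed

lemma (in primeideal) submonoid_compl: "submonoid (carrier R - I) R"
  by standard (use I_prime one_notin in auto)

text \<open>For a finitely generated projective module, the coordinate functionals of a basis at \<open>p\<close> lift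
  to functionals \<open>\<psi> i\<close> on the module itself once a denominator is cleared, and the basis vectors
  become elements \<open>w k\<close> of the module in the same way. Their matrix is diagonal at \<open>p\<close> with
  invertible diagonal entries; membership in \<open>p\<close> is insensitive to the denominators.\<close>

theorem (in module) ex_diagonal_mod_prime:
  fixes r :: nat
  assumes proj: "projective R M" and X: "finite X" "generates X"
    and p: "primeideal p R"
    and iso: "mod_isomorphic (loc_ring R (carrier R - p)) (loc_module R (carrier R - p) M)
      (free_module (loc_ring R (carrier R - p)) {..<r})"
  shows "\<exists>\<psi> w. \<forall>i<r. \<psi> i \<in> dual \<and> w i \<in> carrier M \<and> (\<forall>k<r. \<psi> i (w k) \<in> p \<longleftrightarrow> i \<noteq> k)"
proof -
  interpret p: primeideal p R by (rule p)
  define S where "S = carrier R - p"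
  define L where "L = loc_ring R S"
  define q where "q = fraction R S (regular_module R)"
  have S: "submonoid S R" unfolding S_def by (rule p.submonoid_compl)
  interpret loc: localization R M S
    by (intro localization.intro localization_axioms.intro S module_axioms)
  interpret L: cring L unfolding L_def by (rule R.cring_loc_ring[OF S])
  have S1: "\<one> \<in> S" and SR: "s \<in> S \<Longrightarrow> s \<in> carrier R" for s
    by auto
  have qL: "q a s \<in> carrier L" if "a \<in> carrier R" "s \<in> S" for a s
    unfolding q_def L_def by (rule R.fraction_carrier[OF that])
  have oneL: "\<one>\<^bsub>L\<^esub> = q \<one> \<one>" and zeroL: "\<zero>\<^bsub>L\<^esub> = q \<zero> \<one>"
    by (simp_all add: L_def q_def loc_ring_def loc_module_def regular_module_def)
  have qmult: "q b \<one> \<otimes>\<^bsub>L\<^esub> q c \<one> = q (b \<otimes> c) \<one>" if "b \<in> carrier R" "c \<in> carrier R" for b c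
    using R.loc_ring_mult_fraction[OF S that(1) S1 that(2) S1] by (simp add: q_def L_def)
  define E where "E = loc_module R S M"
  define B where "B = free_module L {..<r}"
  obtain g where g: "g \<in> mod_hom L E B" and bij: "bij_betw g (carrier E) (carrier B)"
    using iso unfolding mod_isomorphic_def S_def[symmetric] L_def[symmetric] E_def[symmetric] B_def[symmetric]
    by blast
  obtain I :: "'c set" and J \<alpha> \<beta> where J: "finite J" "J \<subseteq> I"
    and \<alpha>: "\<alpha> \<in> mod_hom R M (free_module R I)" and \<beta>: "\<beta> \<in> mod_hom R (free_module R I) M"
    and retr: "\<forall>z\<in>carrier M. \<beta> (\<alpha> z) = z \<and> (\<forall>i. \<alpha> z i \<noteq> \<zero> \<longrightarrow> i \<in> J)"
    using fg_projective_retract[OF proj X] by (elim exE conjE) (rule that)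
  have \<beta>\<alpha>: "\<And>z. z \<in> carrier M \<Longrightarrow> \<beta> (\<alpha> z) = z"
    and supp: "\<And>z i. z \<in> carrier M \<Longrightarrow> \<alpha> z i \<noteq> \<zero> \<Longrightarrow> i \<in> J"
    using retr by simp_all
  define F where "F = free_module R I"
  note \<alpha> = \<alpha>[folded F_def] and \<beta> = \<beta>[folded F_def]
  have fE: "fraction R S M z s \<in> carrier E" if "z \<in> carrier M" "s \<in> S" for z s
    using that by (auto simp: E_def loc_module_def)
  have gc: "g Z i \<in> carrier L" if "Z \<in> carrier E" "i < r" for Z i
    using g that by (auto simp: mod_hom_def B_def free_module_def)
  have gadd: "g (Y \<oplus>\<^bsub>E\<^esub> Z) i = g Y i \<oplus>\<^bsub>L\<^esub> g Z i" if "Y \<in> carrier E" "Z \<in> carrier E" for Y Z i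
    using g that by (simp add: mod_hom_def B_def free_module_def)
  have gsm: "g (a \<odot>\<^bsub>E\<^esub> Z) i = a \<otimes>\<^bsub>L\<^esub> g Z i" if "a \<in> carrier L" "Z \<in> carrier E" for a Z i
    using g that by (simp add: mod_hom_def B_def free_module_def)
  have lift: "\<exists>\<psi> t. \<psi> \<in> dual \<and> t \<in> S \<and> (\<forall>z\<in>carrier M. g (fraction R S M z \<one>) i = q (\<psi> z) t)"
    if i: "i < r" for i
  proof -
    define G where "G v = g (fraction R S M (\<beta> v) \<one>) i" for v
    have \<beta>M: "\<beta> v \<in> carrier M" if "v \<in> carrier F" for v using \<beta> that by (auto simp: mod_hom_def)
    have "\<exists>t\<in>S. \<exists>\<Psi>\<in>mod_hom R F (regular_module R).
        \<forall>v\<in>carrier F. (\<forall>i. v i \<noteq> \<zero> \<longrightarrow> i \<in> J) \<longrightarrow> G v = q (\<Psi> v) t"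
      unfolding F_def q_def
    proof (rule R.ex_dual_lift_free[OF S J], unfold F_def[symmetric] q_def[symmetric] L_def[symmetric])
      show "G v \<in> carrier L" if "v \<in> carrier F" for v
        using gc[OF fE[OF \<beta>M[OF that] S1] i] by (simp add: G_def)
      show "G (v \<oplus>\<^bsub>F\<^esub> w) = G v \<oplus>\<^bsub>L\<^esub> G w" if "v \<in> carrier F" "w \<in> carrier F" for v w
      proof -
        have "fraction R S M (\<beta> (v \<oplus>\<^bsub>F\<^esub> w)) \<one> = fraction R S M (\<beta> v) \<one> \<oplus>\<^bsub>E\<^esub> fraction R S M (\<beta> w) \<one>"
          using loc.add_fraction[OF \<beta>M[OF that(1)] S1 \<beta>M[OF that(2)] S1] \<beta> that \<beta>M
          by (simp add: mod_hom_def E_def)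
        then show ?thesis
          using gadd fE \<beta>M that S1 by (simp add: G_def)
      qed
      show "G (a \<odot>\<^bsub>F\<^esub> v) = q a \<one> \<otimes>\<^bsub>L\<^esub> G v" if "a \<in> carrier R" "v \<in> carrier F" for a v
      proof -
        have "fraction R S M (\<beta> (a \<odot>\<^bsub>F\<^esub> v)) \<one> = q a \<one> \<odot>\<^bsub>E\<^esub> fraction R S M (\<beta> v) \<one>"
          using loc.smult_fraction[OF that(1) S1 \<beta>M[OF that(2)] S1] \<beta> that
          by (simp add: mod_hom_def E_def q_def)
        then show ?thesis
          using gsm[OF qL[OF that(1) S1] fE[OF \<beta>M[OF that(2)] S1]] by (simp add: G_def)
      qed
    qed
    then obtain t \<Psi> where t: "t \<in> S" and \<Psi>: "\<Psi> \<in> mod_hom R F (regular_module R)"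
      and eq: "\<And>v. v \<in> carrier F \<Longrightarrow> \<forall>i. v i \<noteq> \<zero> \<longrightarrow> i \<in> J \<Longrightarrow> G v = q (\<Psi> v) t" by blast
    have \<alpha>F: "\<alpha> z \<in> carrier F" if "z \<in> carrier M" for z using \<alpha> that by (auto simp: mod_hom_def)
    have "(\<lambda>z. \<Psi> (\<alpha> z)) \<in> dual"
      using \<alpha> \<Psi> \<alpha>F by (intro dualI) (auto simp: mod_hom_def regular_module_def)
    moreover have "g (fraction R S M z \<one>) i = q (\<Psi> (\<alpha> z)) t" if "z \<in> carrier M" for z
      using eq[OF \<alpha>F[OF that]] supp[OF that] \<beta>\<alpha>[OF that] by (simp add: G_def)
    ultimately show ?thesis using t by blast
  qed
  define e where "e k = (\<lambda>i. if i = k then \<one>\<^bsub>L\<^esub> else \<zero>\<^bsub>L\<^esub>)" for k :: nat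
  have pre: "\<exists>w s. w \<in> carrier M \<and> s \<in> S \<and> (\<forall>i. g (fraction R S M w \<one>) i = q s \<one> \<otimes>\<^bsub>L\<^esub> e k i)"
    if k: "k < r" for k
  proof -
    have "e k \<in> carrier B" using k by (auto simp: e_def B_def free_module_def)
    then have "e k \<in> g ` carrier E" using bij by (simp add: bij_betw_def)
    then obtain Z where Z: "Z \<in> carrier E" "g Z = e k" by (metis imageE)
    then obtain w s where w: "Z = fraction R S M w s" "w \<in> carrier M" "s \<in> S"
      by (auto simp: E_def loc_module_def)
    have "q s \<one> \<odot>\<^bsub>E\<^esub> Z = fraction R S M (s \<odot>\<^bsub>M\<^esub> w) (\<one> \<otimes> s)"
      unfolding w(1) q_def E_def using w by (intro loc.smult_fraction) auto
    also have "\<dots> = fraction R S M w \<one>"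
      using w by (intro loc.fraction_eqI[of _ _ _ _ \<one>]) auto
    finally have "g (fraction R S M w \<one>) i = q s \<one> \<otimes>\<^bsub>L\<^esub> e k i" for i
      using gsm[OF qL[OF SR[OF w(3)] S1] Z(1), of i] Z(2) by simp
    then show ?thesis using w by blast
  qed
  have "\<forall>i. \<exists>\<psi>t. i < r \<longrightarrow> fst \<psi>t \<in> dual \<and> snd \<psi>t \<in> S \<and>
      (\<forall>z\<in>carrier M. g (fraction R S M z \<one>) i = q (fst \<psi>t z) (snd \<psi>t))"
    using lift by simp
  from choice[OF this] obtain \<psi>t where *: "\<forall>i. i < r \<longrightarrow> fst (\<psi>t i) \<in> dual \<and> snd (\<psi>t i) \<in> S \<and>
      (\<forall>z\<in>carrier M. g (fraction R S M z \<one>) i = q (fst (\<psi>t i) z) (snd (\<psi>t i)))"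
    by (elim exE)
  define \<psi> where "\<psi> i = fst (\<psi>t i)" for i
  define t where "t i = snd (\<psi>t i)" for i
  have \<psi>: "\<And>i. i < r \<Longrightarrow> \<psi> i \<in> dual" and t: "\<And>i. i < r \<Longrightarrow> t i \<in> S"
    and \<psi>eq: "\<And>i z. i < r \<Longrightarrow> z \<in> carrier M \<Longrightarrow> g (fraction R S M z \<one>) i = q (\<psi> i z) (t i)"
    unfolding \<psi>_def t_def using * by blast+
  have "\<forall>k. \<exists>ws. k < r \<longrightarrow> fst ws \<in> carrier M \<and> snd ws \<in> S \<and>
      (\<forall>i. g (fraction R S M (fst ws) \<one>) i = q (snd ws) \<one> \<otimes>\<^bsub>L\<^esub> e k i)"
    using pre by simp
  from choice[OF this] obtain ws where *: "\<forall>k. k < r \<longrightarrow> fst (ws k) \<in> carrier M \<and> snd (ws k) \<in> S \<and>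
      (\<forall>i. g (fraction R S M (fst (ws k)) \<one>) i = q (snd (ws k)) \<one> \<otimes>\<^bsub>L\<^esub> e k i)"
    by (elim exE)
  define w where "w k = fst (ws k)" for k
  define s where "s k = snd (ws k)" for k
  have w: "\<And>k. k < r \<Longrightarrow> w k \<in> carrier M" and s: "\<And>k. k < r \<Longrightarrow> s k \<in> S"
    and weq: "\<And>k i. k < r \<Longrightarrow> g (fraction R S M (w k) \<one>) i = q (s k) \<one> \<otimes>\<^bsub>L\<^esub> e k i"
    unfolding w_def s_def using * by blast+
  have "\<psi> i (w k) \<in> p \<longleftrightarrow> i \<noteq> k" if i: "i < r" and k: "k < r" for i k
  proof -
    let ?c = "if i = k then s k else \<zero>"
    have c: "?c \<in> carrier R" using SR s k by simp
    have pc: "\<psi> i (w k) \<in> carrier R" by (rule dual_closed[OF \<psi>[OF i] w[OF k]])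
    have "q (\<psi> i (w k)) (t i) = q (s k) \<one> \<otimes>\<^bsub>L\<^esub> e k i"
      using weq[OF k] \<psi>eq[OF i w[OF k]] by simp
    also have "\<dots> = q ?c \<one>"
      using qmult[of "s k"] SR[OF s[OF k]] by (simp add: e_def oneL zeroL)
    finally obtain u where u: "u \<in> S" "u \<otimes> (\<one> \<otimes> \<psi> i (w k)) = u \<otimes> (t i \<otimes> ?c)"
      unfolding q_def using R.loc_ring_fraction_eq_iff[OF S pc t[OF i] c S1] by blast
    have uR: "u \<in> carrier R" "u \<notin> p" using u(1) by (simp_all add: S_def)
    have "\<psi> i (w k) \<in> p \<longleftrightarrow> u \<otimes> \<psi> i (w k) \<in> p"
      using p.I_prime[OF uR(1) pc] uR p.I_l_closed by blast
    also have "u \<otimes> \<psi> i (w k) = u \<otimes> (t i \<otimes> ?c)" using u pc by simp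
    also have "\<dots> \<in> p \<longleftrightarrow> i \<noteq> k"
    proof (cases "i = k")
      case True
      have "u \<otimes> (t k \<otimes> s k) \<in> S" using u t s k by simp
      then show ?thesis using True by (simp add: S_def)
    next
      case False
      then show ?thesis using uR SR[OF t[OF i]] by simp
    qed
    finally show ?thesis .
  qed
  then show ?thesis using \<psi> w by blast
qed

section \<open>Translates in finitely generated projective modules\<close>

lemma (in module) Um_direct_sum_regular_notin_prime:
  assumes um: "(a, x) \<in> Um R (direct_sum (regular_module R) M)"
    and p: "primeideal p R" and sub: "order_ideal x \<subseteq> p"
  shows "a \<notin> p"
proof
  assume a: "a \<in> p"
  interpret p: primeideal p R by (rule p)
  let ?D = "direct_sum (regular_module R) M"
  obtain \<phi> where \<phi>: "\<phi> \<in> mod_hom R ?D (regular_module R)" "\<phi> (a, x) = \<one>"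
    and ax: "(a, x) \<in> carrier ?D"
    using um by (auto simp: Um_def)
  have D: "carrier ?D = carrier R \<times> carrier M"
    "(b, y) \<oplus>\<^bsub>?D\<^esub> (c, z) = (b \<oplus> c, y \<oplus>\<^bsub>M\<^esub> z)"
    "c \<odot>\<^bsub>?D\<^esub> (b, y) = (c \<otimes> b, c \<odot>\<^bsub>M\<^esub> y)" for b c y z
    by (simp_all add: direct_sum_def regular_module_def)
  have add: "\<phi> (v \<oplus>\<^bsub>?D\<^esub> w) = \<phi> v \<oplus> \<phi> w" if "v \<in> carrier ?D" "w \<in> carrier ?D" for v w
    using \<phi>(1) that by (simp add: mod_hom_def regular_module_def)
  have sm: "\<phi> (c \<odot>\<^bsub>?D\<^esub> v) = c \<otimes> \<phi> v" if "c \<in> carrier R" "v \<in> carrier ?D" for c v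
    using \<phi>(1) that by (simp add: mod_hom_def regular_module_def)
  have cl: "\<phi> v \<in> carrier R" if "v \<in> carrier ?D" for v
    using \<phi>(1) that by (auto simp: mod_hom_def regular_module_def)
  have aR: "a \<in> carrier R" and xM: "x \<in> carrier M" using ax by (simp_all add: D(1))
  have "(\<lambda>z. \<phi> (\<zero>, z)) \<in> dual"
  proof (rule dualI)
    show "\<phi> (\<zero>, z) \<in> carrier R" if "z \<in> carrier M" for z using cl that by (simp add: D(1))
    show "\<phi> (\<zero>, y \<oplus>\<^bsub>M\<^esub> z) = \<phi> (\<zero>, y) \<oplus> \<phi> (\<zero>, z)" if "y \<in> carrier M" "z \<in> carrier M" for y z
      using add[of "(\<zero>, y)" "(\<zero>, z)"] that by (simp add: D)
    show "\<phi> (\<zero>, c \<odot>\<^bsub>M\<^esub> z) = c \<otimes> \<phi> (\<zero>, z)" if "c \<in> carrier R" "z \<in> carrier M" for c z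
      using sm[of c "(\<zero>, z)"] that by (simp add: D)
  qed
  then have "\<phi> (\<zero>, x) \<in> p" using sub by (auto simp: order_ideal_def)
  moreover have "\<phi> (a, \<zero>\<^bsub>M\<^esub>) \<in> p"
  proof -
    have "\<phi> (a, \<zero>\<^bsub>M\<^esub>) = a \<otimes> \<phi> (\<one>, \<zero>\<^bsub>M\<^esub>)"
      using sm[of a "(\<one>, \<zero>\<^bsub>M\<^esub>)"] aR by (simp add: D)
    then show ?thesis using p.I_r_closed[OF a] cl[of "(\<one>, \<zero>\<^bsub>M\<^esub>)"] by (simp add: D(1))
  qed
  moreover have "\<one> = \<phi> (a, \<zero>\<^bsub>M\<^esub>) \<oplus> \<phi> (\<zero>, x)"
    using add[of "(a, \<zero>\<^bsub>M\<^esub>)" "(\<zero>, x)"] aR xM \<phi>(2) by (simp add: D)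
  ultimately show False using p.a_closed p.one_notin by metis
qed

text \<open>The basis elements at \<open>p\<close> may be replaced by elements of \<open>W\<close>: up to units and elements of
  \<open>W\<close>, every element is a multiple of \<open>x\<close>, and all functionals take values in \<open>p\<close> at \<open>x\<close>. So
  the replacement does not affect the matrix modulo \<open>p\<close>.\<close>

lemma (in translation_module) dual_systems_not_subset_prime:
  fixes n r :: nat
  assumes proj: "projective R M" and X: "finite X" "generates X"
    and rank: "has_constant_rank R M r" and n: "n \<le> r"
    and x: "x \<in> carrier M"
    and span: "\<And>z. z \<in> carrier M \<Longrightarrow>
      \<exists>u\<in>Units R. \<exists>c\<in>carrier R. \<exists>y\<in>W. u \<odot>\<^bsub>M\<^esub> z = c \<odot>\<^bsub>M\<^esub> x \<oplus>\<^bsub>M\<^esub> y"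
    and p: "primeideal p R" and sub: "order_ideal x \<subseteq> p"
  shows "\<not> dual_systems W n \<subseteq> p"
proof -
  interpret p: primeideal p R by (rule p)
  have "mod_isomorphic (loc_ring R (carrier R - p)) (loc_module R (carrier R - p) M)
      (free_module (loc_ring R (carrier R - p)) {..<r})"
    using rank p unfolding has_constant_rank_def by blast
  from ex_diagonal_mod_prime[OF proj X p this] obtain \<psi> w where
    *: "\<forall>i<r. \<psi> i \<in> dual \<and> w i \<in> carrier M \<and> (\<forall>k<r. \<psi> i (w k) \<in> p \<longleftrightarrow> i \<noteq> k)"
    by (elim exE)
  then have \<psi>: "\<And>i. i < n \<Longrightarrow> \<psi> i \<in> dual" and w: "\<And>i. i < n \<Longrightarrow> w i \<in> carrier M"
    and diag: "\<And>i k. i < n \<Longrightarrow> k < n \<Longrightarrow> \<psi> i (w k) \<in> p \<longleftrightarrow> i \<noteq> k"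
    using n by simp_all
  have "\<exists>y\<in>W. \<forall>i<n. \<psi> i y \<in> p \<longleftrightarrow> \<psi> i (w k) \<in> p" if k: "k < n" for k
  proof -
    obtain u c y where u: "u \<in> Units R" and c: "c \<in> carrier R" and y: "y \<in> W"
      and eq: "u \<odot>\<^bsub>M\<^esub> w k = c \<odot>\<^bsub>M\<^esub> x \<oplus>\<^bsub>M\<^esub> y"
      using span[OF w[OF k]] by blast
    have uR: "u \<in> carrier R" using u by blast
    have yM: "y \<in> carrier M" using y W_subset by blast
    have "\<psi> i y \<in> p \<longleftrightarrow> \<psi> i (w k) \<in> p" if i: "i < n" for i
    proof -
      have cl: "\<psi> i y \<in> carrier R" "\<psi> i (w k) \<in> carrier R" "\<psi> i x \<in> carrier R"
        using dual_closed[OF \<psi>[OF i]] yM w[OF k] x by blast+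
      have xp: "c \<otimes> \<psi> i x \<in> p"
        using p.I_l_closed c sub \<psi>[OF i] by (auto simp: order_ideal_def)
      have val: "u \<otimes> \<psi> i (w k) = c \<otimes> \<psi> i x \<oplus> \<psi> i y"
        using arg_cong[OF eq, of "\<psi> i"] dual_smult[OF \<psi>[OF i]] dual_add[OF \<psi>[OF i]] uR c x yM w[OF k]
        by simp
      have up: "u \<notin> p"
      proof
        assume "u \<in> p"
        then have "inv u \<otimes> u \<in> p" using p.I_l_closed u by blast
        then show False using p.one_notin u by simp
      qed
      have "\<psi> i (w k) \<in> p \<longleftrightarrow> u \<otimes> \<psi> i (w k) \<in> p"
        using p.I_prime[OF uR cl(2)] up p.I_l_closed uR by blast
      also have "\<dots> \<longleftrightarrow> \<psi> i y \<in> p"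
      proof
        assume "\<psi> i y \<in> p"
        then show "u \<otimes> \<psi> i (w k) \<in> p" unfolding val using p.a_closed xp by blast
      next
        assume "u \<otimes> \<psi> i (w k) \<in> p"
        then have "\<ominus> (c \<otimes> \<psi> i x) \<oplus> (c \<otimes> \<psi> i x \<oplus> \<psi> i y) \<in> p"
          unfolding val by (rule p.a_closed[OF p.a_inv_closed[OF xp]])
        then show "\<psi> i y \<in> p" using c cl by (simp add: R.r_neg1)
      qed
      finally show ?thesis by simp
    qed
    then show ?thesis using y by blast
  qed
  then have "\<forall>k. \<exists>y. k < n \<longrightarrow> y \<in> W \<and> (\<forall>i<n. \<psi> i y \<in> p \<longleftrightarrow> \<psi> i (w k) \<in> p)" by blast
  from choice[OF this] obtain y where
    y: "\<forall>k. k < n \<longrightarrow> y k \<in> W \<and> (\<forall>i<n. \<psi> i (y k) \<in> p \<longleftrightarrow> \<psi> i (w k) \<in> p)"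
    by (elim exE)
  have "\<exists>\<delta>\<in>dual_systems W n. \<delta> \<notin> p"
  proof (rule ex_dual_system_notin_prime[OF p W_subset, of n \<psi> y])
    show "\<psi> i \<in> dual" if "i < n" for i by (rule \<psi>[OF that])
    show "y i \<in> W" if "i < n" for i using y that by simp
    show "\<psi> i (y k) \<in> p \<longleftrightarrow> i \<noteq> k" if "i < n" "k < n" for i k using y that diag by simp
  qed
  then show ?thesis by blast
qed

lemma no_prime_chain_of_krull_dim:
  assumes "krull_dim R \<le> enat d"
  shows "no_prime_chain R I (Suc d)"
  unfolding no_prime_chain_def
proof
  assume "\<exists>p :: nat \<Rightarrow> 'a set. (\<forall>i\<le>Suc d. primeideal (p i) R \<and> I \<subseteq> p i) \<and> (\<forall>i<Suc d. p i \<subset> p (Suc i))"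
  then have "enat (Suc d) \<in> {enat n | n. \<exists>p :: nat \<Rightarrow> 'a set.
           (\<forall>i\<le>n. primeideal (p i) R) \<and> (\<forall>i<n. p i \<subset> p (Suc i))}" by blast
  from Sup_upper[OF this] have "enat (Suc d) \<le> krull_dim R" unfolding krull_dim_def .
  then show False using assms by (meson enat_ord_simps(1) not_less_eq_eq order_refl order_trans)
qed

section \<open>Clearing denominators\<close>

context localization begin

abbreviation \<iota>
  where "\<iota> \<equiv> loc_map R S (regular_module R)"

abbreviation \<kappa>
  where "\<kappa> \<equiv> loc_map R S M"

lemma loc_map_ring_closed: "a \<in> carrier R \<Longrightarrow> \<iota> a \<in> carrier (loc_ring R S)"
  unfolding loc_map_def by (rule R.fraction_carrier[OF _ S_one])

lemma loc_map_closed: "z \<in> carrier M \<Longrightarrow> \<kappa> z \<in> carrier (loc_module R S M)"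
  unfolding loc_map_def loc_module_def by auto

lemma loc_map_mult:
  assumes "a \<in> carrier R" "b \<in> carrier R"
  shows "\<iota> (a \<otimes> b) = \<iota> a \<otimes>\<^bsub>loc_ring R S\<^esub> \<iota> b"
  using R.loc_ring_mult_fraction[OF S assms(1) S_one assms(2) S_one] by (simp add: loc_map_def)

lemma loc_map_add:
  assumes "y \<in> carrier M" "z \<in> carrier M"
  shows "\<kappa> (y \<oplus>\<^bsub>M\<^esub> z) = \<kappa> y \<oplus>\<^bsub>loc_module R S M\<^esub> \<kappa> z"
  using add_fraction[OF assms(1) S_one assms(2) S_one] assms by (simp add: loc_map_def)

lemma loc_map_smult:
  assumes "a \<in> carrier R" "z \<in> carrier M"
  shows "\<kappa> (a \<odot>\<^bsub>M\<^esub> z) = \<iota> a \<odot>\<^bsub>loc_module R S M\<^esub> \<kappa> z"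
  using smult_fraction[OF assms(1) S_one assms(2) S_one] by (simp add: loc_map_def)

lemma loc_map_unit:
  assumes s: "s \<in> S"
  shows "\<iota> s \<in> Units (loc_ring R S)"
proof -
  interpret L: cring "loc_ring R S" by (rule R.cring_loc_ring[OF S])
  let ?q = "fraction R S (regular_module R)"
  have sR: "s \<in> carrier R" using s by simp
  have "?q \<one> s \<otimes>\<^bsub>loc_ring R S\<^esub> \<iota> s = ?q s s"
    unfolding loc_map_def
    using R.loc_ring_mult_fraction[OF S R.one_closed s sR S_one] sR by simp
  also have "\<dots> = \<one>\<^bsub>loc_ring R S\<^esub>"
    using R.loc_ring_fraction_eq_iff[OF S sR s R.one_closed S_one] sR S_one by (auto simp: loc_ring_def)
  finally have "?q \<one> s \<otimes>\<^bsub>loc_ring R S\<^esub> \<iota> s = \<one>\<^bsub>loc_ring R S\<^esub>" .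
  moreover have q: "?q \<one> s \<in> carrier (loc_ring R S)" by (rule R.fraction_carrier[OF R.one_closed s])
  moreover note L.m_comm[OF q loc_map_ring_closed[OF sR]]
  ultimately show ?thesis
    using loc_map_ring_closed[OF sR] unfolding Units_def by force
qed

lemma clear_denominator_ring:
  assumes "X \<in> carrier (loc_ring R S)"
  shows "\<exists>s\<in>S. \<exists>b\<in>carrier R. \<iota> s \<otimes>\<^bsub>loc_ring R S\<^esub> X = \<iota> b"
proof -
  let ?q = "fraction R S (regular_module R)"
  obtain b s where X: "X = ?q b s" and b: "b \<in> carrier R" and s: "s \<in> S"
    by (rule R.loc_ring_carrierE[OF assms])
  have sR: "s \<in> carrier R" using s by simp
  have "\<iota> s \<otimes>\<^bsub>loc_ring R S\<^esub> X = ?q (s \<otimes> b) s"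
    unfolding loc_map_def X using R.loc_ring_mult_fraction[OF S sR S_one b s] sR by simp
  also have "\<dots> = \<iota> b"
    unfolding loc_map_def
    using R.loc_ring_fraction_eq_iff[OF S _ s b S_one, of "s \<otimes> b"] sR b S_one by auto
  finally show ?thesis using s b by blast
qed

lemma clear_denominator:
  assumes "Z \<in> carrier (loc_module R S M)"
  shows "\<exists>s\<in>S. \<exists>z\<in>carrier M. \<iota> s \<odot>\<^bsub>loc_module R S M\<^esub> Z = \<kappa> z"
proof -
  obtain z s where Z: "Z = fraction R S M z s" and z: "z \<in> carrier M" and s: "s \<in> S"
    using assms by (auto simp: loc_module_def)
  have sR: "s \<in> carrier R" using s by simp
  have "\<iota> s \<odot>\<^bsub>loc_module R S M\<^esub> Z = fraction R S M (s \<odot>\<^bsub>M\<^esub> z) s"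
    unfolding loc_map_def Z using smult_fraction[OF sR S_one z s] sR by simp
  also have "\<dots> = \<kappa> z"
    unfolding loc_map_def using sR z s by (intro fraction_eqI[of _ _ _ _ \<one>]) auto
  finally show ?thesis using s z by blast
qed

lemma generates_loc_module:
  assumes X: "generates X"
  shows "module.generates (loc_ring R S) (loc_module R S M) (\<kappa> ` X)"
proof -
  interpret P: module "loc_ring R S" "loc_module R S M" by (rule module_loc_module)
  have XM: "X \<subseteq> carrier M" using X unfolding generates_def by blast
  have "H = carrier (loc_module R S M)"
    if H: "submodule H (loc_ring R S) (loc_module R S M)" "\<kappa> ` X \<subseteq> H" for H
  proof
    note HE = P.submoduleE[OF H(1)]
    show "H \<subseteq> carrier (loc_module R S M)" by (rule HE(1))
    let ?K = "{z \<in> carrier M. \<kappa> z \<in> H}"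
    have "submodule ?K R M"
    proof (rule submoduleI)
      show "?K \<subseteq> carrier M" by blast
      have sm: "a \<odot>\<^bsub>M\<^esub> z \<in> ?K" if "a \<in> carrier R" "z \<in> ?K" for a z
        using that HE(4)[OF loc_map_ring_closed] loc_map_smult by simp
      then show "a \<odot>\<^bsub>M\<^esub> z \<in> ?K" if "a \<in> carrier R" "z \<in> ?K" for a z using that by blast
      show "y \<oplus>\<^bsub>M\<^esub> z \<in> ?K" if "y \<in> ?K" "z \<in> ?K" for y z
        using that HE(5) loc_map_add by simp
      show "\<ominus>\<^bsub>M\<^esub> z \<in> ?K" if "z \<in> ?K" for z
        using sm[of "\<ominus> \<one>" z] that by (simp add: smult_l_minus)
      obtain h where h: "h \<in> H" using HE(2) by blast
      then have "h \<in> carrier (loc_module R S M)" using HE(1) by blast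
      from clear_denominator[OF this] obtain s z where sz: "s \<in> S" "z \<in> carrier M"
        "\<iota> s \<odot>\<^bsub>loc_module R S M\<^esub> h = \<kappa> z" by blast
      then have "z \<in> ?K" using HE(4)[OF loc_map_ring_closed h, of s] by simp
      then show "\<zero>\<^bsub>M\<^esub> \<in> ?K" using sm[of \<zero> z] by simp
    qed
    moreover have "X \<subseteq> ?K" using XM H(2) by blast
    ultimately have K: "?K = carrier M"
      by (rule X[unfolded generates_def, THEN conjunct2, rule_format])
    show "carrier (loc_module R S M) \<subseteq> H"
    proof
      fix Z assume Z: "Z \<in> carrier (loc_module R S M)"
      from clear_denominator[OF this] obtain s z where sz: "s \<in> S" "z \<in> carrier M"
        "\<iota> s \<odot>\<^bsub>loc_module R S M\<^esub> Z = \<kappa> z" by blast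
      have "z \<in> ?K" using sz(2) by (subst K)
      then have "\<iota> s \<odot>\<^bsub>loc_module R S M\<^esub> Z \<in> H" using sz(3) by simp
      moreover have u: "\<iota> s \<in> Units (loc_ring R S)" by (rule loc_map_unit[OF sz(1)])
      note HE(4)[OF P.R.Units_inv_closed[OF u]]
      ultimately have "inv\<^bsub>loc_ring R S\<^esub> \<iota> s \<odot>\<^bsub>loc_module R S M\<^esub> (\<iota> s \<odot>\<^bsub>loc_module R S M\<^esub> Z) \<in> H"
        by blast
      then show "Z \<in> H"
        using u Z by (simp add: P.smult_assoc1[symmetric] P.R.Units_closed)
    qed
  qed
  then show ?thesis
    unfolding P.generates_def using XM loc_map_closed by blast
qed

end

lemma (in module) generates_add_span:
  assumes "X \<subseteq> carrier M" "x \<in> carrier M"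
    and "carrier M = {b \<odot>\<^bsub>M\<^esub> x | b. b \<in> carrier R} <+>\<^bsub>M\<^esub> submodule_span R M X"
  shows "generates (insert x X)"
  unfolding generates_def
proof (intro conjI allI impI)
  show "insert x X \<subseteq> carrier M" using assms by blast
  fix H assume H: "submodule H R M" "insert x X \<subseteq> H"
  note HE = submoduleE[OF H(1)]
  have "submodule_span R M X \<subseteq> H"
    unfolding submodule_span_def by (rule hull_minimal) (use H in auto)
  then have "{b \<odot>\<^bsub>M\<^esub> x | b. b \<in> carrier R} <+>\<^bsub>M\<^esub> submodule_span R M X \<subseteq> H"
    using HE(4,5) H(2) by (auto simp: set_add_def')
  then have "carrier M \<subseteq> H" by (subst assms(3))
  then show "H = carrier M" using HE(1) by blast
qed

section \<open>Unimodular translates in modules of fractions\<close>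

theorem theorem2p5:
  fixes A :: "('a, 'k) ring_scheme"
    and S :: "'a set"
    and Q :: "('a, 'm, 'l) module_scheme"
    and R :: "('a \<times> 'a) set ring"
    and P :: "(('a \<times> 'a) set, ('m \<times> 'a) set) module"
    and Q' :: "'m set"
    and a s :: 'a
    and x :: 'm
    and d r :: nat
  assumes "cring A" and "\<one>\<^bsub>A\<^esub> \<noteq> \<zero>\<^bsub>A\<^esub>"
    and "submonoid S A"
    and "R = loc_ring A S" and "\<one>\<^bsub>R\<^esub> \<noteq> \<zero>\<^bsub>R\<^esub>"
    and "krull_dim R \<le> enat d"
    and "Module.module A Q" and "finitely_presented A Q"
    and "P = loc_module A S Q"
    and "projective R P" and "has_constant_rank R P r" and "r \<ge> d + 1"
    and "a \<in> carrier A" and "x \<in> carrier Q"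
    and "(loc_map A S (regular_module A) a, loc_map A S Q x) \<in> Um R (direct_sum (regular_module R) P)"
    and "fg_submodule Q' A Q"
    and "carrier Q = {b \<odot>\<^bsub>Q\<^esub> x | b. b \<in> carrier A} <+>\<^bsub>Q\<^esub> Q'"
    and "s \<in> S"
  shows "\<exists>y\<in>Q'. loc_map A S Q (x \<oplus>\<^bsub>Q\<^esub> (s \<otimes>\<^bsub>A\<^esub> a) \<odot>\<^bsub>Q\<^esub> y) \<in> Um R P"
proof -
  interpret loc: localization A Q S
    by (intro localization.intro localization_axioms.intro assms)
  interpret P: module R P
    using loc.module_loc_module by (simp add: assms)
  let ?i = "loc_map A S (regular_module A)" and ?k = "loc_map A S Q"
  obtain X where X: "finite X" "X \<subseteq> carrier Q" "Q' = submodule_span A Q X"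
    and Q': "submodule Q' A Q"
    using assms(16) unfolding fg_submodule_def by blast
  note QE = loc.submoduleE[OF Q']
  have ak: "\<And>y z. y \<in> carrier Q \<Longrightarrow> z \<in> carrier Q \<Longrightarrow> ?k (y \<oplus>\<^bsub>Q\<^esub> z) = ?k y \<oplus>\<^bsub>P\<^esub> ?k z"
    and smk: "\<And>b z. b \<in> carrier A \<Longrightarrow> z \<in> carrier Q \<Longrightarrow> ?k (b \<odot>\<^bsub>Q\<^esub> z) = ?i b \<odot>\<^bsub>P\<^esub> ?k z"
    and ki: "\<And>b. b \<in> carrier A \<Longrightarrow> ?i b \<in> carrier R"
    and kk: "\<And>z. z \<in> carrier Q \<Longrightarrow> ?k z \<in> carrier P"
    and unit: "\<And>t. t \<in> S \<Longrightarrow> ?i t \<in> Units R"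
    unfolding assms(4,9)
    by (simp_all add: loc.loc_map_add loc.loc_map_smult loc.loc_map_ring_closed loc.loc_map_closed
        loc.loc_map_unit)
  interpret C: translation_module R P "?i ` carrier A" "?k ` Q'"
  proof (intro translation_module.intro translation_module_axioms.intro P.module_axioms)
    show "?i ` carrier A \<subseteq> carrier R" using ki by blast
    show "?k ` Q' \<subseteq> carrier P" using kk QE(1) by blast
    show "\<exists>u\<in>Units R. u \<otimes>\<^bsub>R\<^esub> b \<in> ?i ` carrier A" if "b \<in> carrier R" for b
      using loc.clear_denominator_ring[folded assms(4), OF that] unit by (metis imageI)
    show "y \<oplus>\<^bsub>P\<^esub> z \<in> ?k ` Q'" if yz: "y \<in> ?k ` Q'" "z \<in> ?k ` Q'" for y z
    proof -
      obtain y' z' where *: "y' \<in> Q'" "z' \<in> Q'" "y = ?k y'" "z = ?k z'" using yz by blast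
      then have "?k (y' \<oplus>\<^bsub>Q\<^esub> z') = y \<oplus>\<^bsub>P\<^esub> z" using ak QE(1) by blast
      moreover have "y' \<oplus>\<^bsub>Q\<^esub> z' \<in> Q'" by (rule QE(5)[OF *(1,2)])
      ultimately show ?thesis by (metis imageI)
    qed
    show sm: "b \<odot>\<^bsub>P\<^esub> y \<in> ?k ` Q'" if bY: "b \<in> ?i ` carrier A" "y \<in> ?k ` Q'" for b y
    proof -
      obtain b' y' where *: "b' \<in> carrier A" "y' \<in> Q'" "b = ?i b'" "y = ?k y'" using bY by blast
      then have "?k (b' \<odot>\<^bsub>Q\<^esub> y') = b \<odot>\<^bsub>P\<^esub> y" using smk QE(1) by blast
      moreover have "b' \<odot>\<^bsub>Q\<^esub> y' \<in> Q'" by (rule QE(4)[OF *(1,2)])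
      ultimately show ?thesis by (metis imageI)
    qed
    have "\<zero>\<^bsub>P\<^esub> = ?k \<zero>\<^bsub>Q\<^esub>" by (simp add: assms(9) loc_module_def loc_map_def)
    moreover have "\<zero>\<^bsub>Q\<^esub> \<in> Q'"
      using subgroup.one_closed[OF submodule.axioms(1)[OF Q']] by simp
    ultimately show "\<zero>\<^bsub>P\<^esub> \<in> ?k ` Q'" by blast
  qed
  have gen: "P.generates (?k ` insert x X)"
    using loc.generates_loc_module[OF loc.generates_add_span[OF X(2) assms(14)]] assms(17)
    by (simp add: X(3) assms(4,9))
  have span: "\<exists>u\<in>Units R. \<exists>c\<in>carrier R. \<exists>y\<in>?k ` Q'. u \<odot>\<^bsub>P\<^esub> Z = c \<odot>\<^bsub>P\<^esub> ?k x \<oplus>\<^bsub>P\<^esub> y"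
    if Z: "Z \<in> carrier P" for Z
  proof -
    obtain t z where t: "t \<in> S" "z \<in> carrier Q" "?i t \<odot>\<^bsub>P\<^esub> Z = ?k z"
      using loc.clear_denominator[folded assms(4,9), OF Z] by blast
    have "z \<in> {b \<odot>\<^bsub>Q\<^esub> x | b. b \<in> carrier A} <+>\<^bsub>Q\<^esub> Q'" using t(2) by (subst assms(17)[symmetric])
    then obtain b y where b: "b \<in> carrier A" "y \<in> Q'" "z = b \<odot>\<^bsub>Q\<^esub> x \<oplus>\<^bsub>Q\<^esub> y"
      unfolding set_add_def' by blast
    have "y \<in> carrier Q" using b QE(1) by blast
    then have "?i t \<odot>\<^bsub>P\<^esub> Z = ?i b \<odot>\<^bsub>P\<^esub> ?k x \<oplus>\<^bsub>P\<^esub> ?k y"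
      unfolding t(3) b(3) using b(1) assms(14) by (simp add: ak smk)
    then show ?thesis using unit[OF t(1)] ki[OF b(1)] b(2) by blast
  qed
  have sA: "s \<in> carrier A" using assms(18) by simp
  have unimod: "?i (s \<otimes>\<^bsub>A\<^esub> a) \<notin> p" if p: "primeideal p R" "P.order_ideal (?k x) \<subseteq> p" for p
  proof
    interpret p: primeideal p R by (rule p(1))
    assume "?i (s \<otimes>\<^bsub>A\<^esub> a) \<in> p"
    then have "?i s \<otimes>\<^bsub>R\<^esub> ?i a \<in> p"
      using loc.loc_map_mult[OF sA assms(13)] by (simp add: assms(4))
    then have "inv\<^bsub>R\<^esub> ?i s \<otimes>\<^bsub>R\<^esub> (?i s \<otimes>\<^bsub>R\<^esub> ?i a) \<in> p"
      using p.I_l_closed unit[OF assms(18)] by blast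
    then have "?i a \<in> p"
      using unit[OF assms(18)] ki[OF sA] ki[OF assms(13)] by (simp add: P.m_assoc[symmetric])
    then show False using P.Um_direct_sum_regular_notin_prime[OF assms(15) p] by blast
  qed
  have "\<exists>w\<in>?k ` Q'. ?k x \<oplus>\<^bsub>P\<^esub> ?i (s \<otimes>\<^bsub>A\<^esub> a) \<odot>\<^bsub>P\<^esub> w \<in> Um R P"
  proof (rule C.ex_unimodular_translate)
    show "no_prime_chain R {\<zero>\<^bsub>R\<^esub>} (Suc d)" by (rule no_prime_chain_of_krull_dim[OF assms(6)])
    show "?i (s \<otimes>\<^bsub>A\<^esub> a) \<in> carrier R" using ki sA assms(13) by simp
    show "?k x \<in> carrier P" by (rule kk[OF assms(14)])
    show "?i (s \<otimes>\<^bsub>A\<^esub> a) \<notin> p" if "primeideal p R" "P.order_ideal (?k x) \<subseteq> p" for p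
      by (rule unimod[OF that])
    show "\<not> P.dual_systems (?k ` Q') (Suc d) \<subseteq> p"
      if "primeideal p R" "P.order_ideal (?k x) \<subseteq> p" for p
      using C.dual_systems_not_subset_prime[OF assms(10) _ gen assms(11) _ kk[OF assms(14)] span that]
        X(1) assms(12) by simp
  qed
  then obtain y where y: "y \<in> Q'" "?k x \<oplus>\<^bsub>P\<^esub> ?i (s \<otimes>\<^bsub>A\<^esub> a) \<odot>\<^bsub>P\<^esub> ?k y \<in> Um R P" by blast
  have yQ: "y \<in> carrier Q" using y(1) QE(1) by blast
  have "?k (x \<oplus>\<^bsub>Q\<^esub> (s \<otimes>\<^bsub>A\<^esub> a) \<odot>\<^bsub>Q\<^esub> y) = ?k x \<oplus>\<^bsub>P\<^esub> ?i (s \<otimes>\<^bsub>A\<^esub> a) \<odot>\<^bsub>P\<^esub> ?k y"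
    using assms(13,14) sA yQ by (simp add: ak smk)
  with y show ?thesis by metis
qed

end
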